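(* Let $b_2^{\pm} := (3\pm\sqrt{3})/6$. Let $0<a\le 1$ and let $z\in\mathbb{C}$ with $0<|z|\le 1$. Then $\Phi(\sigma,a,z)\neq 0$ for all real $\sigma\in(-1,0)$ if and only if one of the following holds: [I] $z=1$, and $b_2^-\le a\le 1/2$ or $b_2^+\le a\le 1$; [II] $z\in[-1,1)$ and $(1-z)(1-a)\le 1$; [III] $z\notin\mathbb{R}$ (and $0<a\le 1$ arbitrary).
   Context: For $0<a\le 1$, $z\in\mathbb{C}$ with $0<|z|\le 1$, the Hurwitz-Lerch zeta function is defined by $\Phi(s,a,z):=\sum_{n=0}^\infty z^n (n+a)^{-s}$ for $\sigma=\Re(s)>1$, and elsewhere by analytic continuation in $s$: for $z\neq 1$ it continues to an entire function of $s$, and for $z=1$ (where $\Phi(s,a,1)=\zeta(s,a)$ is the Hurwitz zeta function) it continues to a meromorphic function on $\mathbb{C}$ with only a simple pole at $s=1$. *)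

theory Defs
  imports "HOL-Complex_Analysis.Complex_Analysis"
begin

definition is_hurwitz_lerch :: "real \<Rightarrow> complex \<Rightarrow> (complex \<Rightarrow> complex) \<Rightarrow> bool" where
  "is_hurwitz_lerch a z f \<longleftrightarrow>
     (\<forall>s. Re s > 1 \<longrightarrow> (\<lambda>n. z ^ n * complex_of_real (real n + a) powr (- s)) sums f s) \<and>
     (if z = 1 then f holomorphic_on (- {1}) \<and> is_pole f 1 \<and> zorder f 1 = - 1
      else f holomorphic_on UNIV)"

text \<open>
  The continuation is uniquely determined (see below), except for the irrelevant value at the
  pole \<open>s = 1\<close> when \<open>z = 1\<close>. The definition is intended for \<open>0 < a \<le> 1\<close> and \<open>0 < \<bar>z\<bar> \<le> 1\<close>, where
  the continuation exists classically.
\<close>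

definition hurwitz_lerch :: "complex \<Rightarrow> real \<Rightarrow> complex \<Rightarrow> complex" where
  "hurwitz_lerch s a z = (SOME f. is_hurwitz_lerch a z f) s"

lemma is_hurwitz_lerch_unique:
  assumes "is_hurwitz_lerch a z f" "is_hurwitz_lerch a z g" "z \<noteq> 1 \<or> s \<noteq> 1"
  shows "f s = g s"
proof -
  define A :: "complex set" where "A = (if z = 1 then - {1} else UNIV)"
  have A: "open A" "connected A" "s \<in> A" "{s. Re s > 1} \<subseteq> A"
    using assms(3) connected_punctured_universe[of "1::complex"] by (auto simp: A_def)
  have hol: "f holomorphic_on A" "g holomorphic_on A"
    using assms by (auto simp: A_def is_hurwitz_lerch_def split: if_splits)
  have eq: "f w = g w" if "w \<in> {s. Re s > 1}" for w
    using assms that sums_unique2 unfolding is_hurwitz_lerch_def by blast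
  have "(2::complex) \<in> {s. Re s > 1}" by simp
  hence ne: "{s::complex. Re s > 1} \<noteq> {}" by blast
  show ?thesis
    by (rule analytic_continuation_open[OF open_halfspace_Re_gt A(1) ne A(2) A(4) hol eq A(3)])
qed

definition b2_minus :: real where "b2_minus = (3 - sqrt 3) / 6"

definition b2_plus :: real where "b2_plus = (3 + sqrt 3) / 6"

end

theory Submission
  imports Defs
begin

text \<open>
  Put \<open>h x = exp (- a x) / (1 - z exp (- x))\<close>. For \<open>-1 < \<sigma> < 0\<close> the continuation satisfies
  \<open>\<Gamma>(\<sigma>) \<Phi>(\<sigma>, a, z) = \<integral> (h x - p x) x powr (\<sigma> - 1) dx\<close> over the positive reals, where \<open>p\<close> is the
  part of the Laurent expansion of \<open>h\<close> at 0 of degree at most 0. If \<open>z\<close> is not real, the imaginary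
  part of \<open>h\<close> is strictly monotone, so the integrand has imaginary part of constant sign. If \<open>z\<close> is
  real and the stated condition holds, the integrand itself has constant sign. Otherwise the
  special values \<open>\<Phi>(0, a, z)\<close> and \<open>\<Phi>(-1, a, z)\<close> have opposite signs, and the intermediate value
  theorem gives a zero.

  The kernel \<open>x h x\<close> is regular at 0 both for \<open>z = 1\<close> and for \<open>z \<noteq> 1\<close>. Its Mellin transform divided by
  \<open>\<Gamma>\<close> is an entire function \<open>\<psi>\<close> with \<open>(s - 1) \<Phi>(s, a, z) = \<psi>(s - 1)\<close>, which treats both cases at once.
\<close>

section \<open>Mellin transforms on the positive half-line\<close>

text \<open>Restricting the measure space rather than the integrand keeps indicator functions out of
  the integrals; \<open>integrable_lborel_pos_iff\<close> and \<open>integral_lborel_pos_eq\<close>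
  lead back to set integrals.\<close>

abbreviation lborel_pos :: "real measure" where
  "lborel_pos \<equiv> restrict_space lborel {0<..}"

definition mellin :: "(real \<Rightarrow> complex) \<Rightarrow> complex \<Rightarrow> complex" where
  "mellin f s = (\<integral>x. f x * of_real x powr (s - 1) \<partial>lborel_pos)"

lemma space_lborel_pos: "space lborel_pos = {0<..}"
  by (simp add: space_restrict_space)

lemma integrable_lborel_pos_iff:
  fixes f :: "real \<Rightarrow> 'a :: {banach, second_countable_topology}"
  shows "integrable lborel_pos f \<longleftrightarrow> set_integrable lborel {0<..} f"
  by (subst integrable_restrict_space) (simp_all add: set_integrable_def)

lemma integral_lborel_pos_eq:
  fixes f :: "real \<Rightarrow> 'a :: {banach, second_countable_topology}"
  shows "(\<integral>x. f x \<partial>lborel_pos) = (LINT x:{0<..}|lborel. f x)"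
  by (subst integral_restrict_space) (simp_all add: set_lebesgue_integral_def)

lemma measurable_lborel_pos:
  fixes f :: "real \<Rightarrow> 'a :: {banach, second_countable_topology}"
  assumes "continuous_on {0<..} f"
  shows "f \<in> borel_measurable lborel_pos"
  using borel_measurable_continuous_on_restrict[OF assms]
  by (simp add: measurable_def sets_restrict_space space_restrict_space)

text \<open>Euler's integral is first known for Lebesgue measure, the completion of
  \<open>lborel\<close>. Borel measurability of the integrand carries integrability and value over
  to \<open>lborel\<close>.\<close>

lemma Gamma_has_integral_pos:
  assumes "Re s > 0"
  shows "integrable lborel_pos (\<lambda>x. of_real x powr (s - 1) * of_real (exp (- x)))" (is ?A)
    and "(\<integral>x. of_real x powr (s - 1) * of_real (exp (- x)) \<partial>lborel_pos) = Gamma s" (is ?B)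
proof -
  let ?f = "\<lambda>x::real. complex_of_real x powr (s - 1) * of_real (exp (- x))"
  have f: "?f = (\<lambda>x. of_real x powr (s - 1) / of_real (exp x))"
    by (simp add: fun_eq_iff exp_minus field_simps)
  have ai: "?f absolutely_integrable_on {0<..}"
    unfolding f using absolutely_integrable_Gamma_integral'[OF assms] .
  have m: "set_borel_measurable lborel {0<..} ?f"
    unfolding set_borel_measurable_def
    by (intro borel_measurable_scaleR) measurable
  show ?A
    using ai m unfolding integrable_lborel_pos_iff set_integrable_def set_borel_measurable_def
    by (simp add: integrable_completion)
  have "(LINT x:{0<..}|lborel. ?f x) = (LINT x:{0<..}|lebesgue. ?f x)"
    using m unfolding set_lebesgue_integral_def set_borel_measurable_def
    by (simp add: integral_completion)
  also have "\<dots> = integral {0<..} ?f"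
    by (rule set_lebesgue_integral_eq_integral[OF ai])
  also have "\<dots> = Gamma s"
    using Gamma_integral_complex'[OF assms] unfolding f by (rule integral_unique)
  finally show ?B by (simp add: integral_lborel_pos_eq)
qed

lemma Gamma_scaled_integral_pos:
  assumes "Re s > 0" and c: "c > 0"
  shows "integrable lborel_pos (\<lambda>x. of_real x powr (s - 1) * of_real (exp (- c * x)))" (is ?A)
    and "(\<integral>x. of_real x powr (s - 1) * of_real (exp (- c * x)) \<partial>lborel_pos) = Gamma s * of_real c powr (- s)" (is ?B)
proof -
  let ?f = "\<lambda>x::real. complex_of_real x powr (s - 1) * of_real (exp (- x))"
  let ?g = "\<lambda>x::real. complex_of_real x powr (s - 1) * of_real (exp (- c * x))"
  let ?F = "\<lambda>x. indicator {0<..} x *\<^sub>R ?f x"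
  note * = Gamma_has_integral_pos[OF assms(1), unfolded integrable_lborel_pos_iff
      integral_lborel_pos_eq set_integrable_def set_lebesgue_integral_def]
  \<comment> \<open>The summand 0 gives the argument the affine shape of the substitution rules
    \<open>lborel_integrable_real_affine\<close> and
    \<open>lborel_integral_real_affine\<close>.\<close>
  have F: "?F (0 + c * x) = of_real c powr (s - 1) * (indicator {0<..} x *\<^sub>R ?g x)" for x
    using c by (auto simp: indicator_def zero_less_mult_iff powr_times_real)
  have c0: "of_real c powr (s - 1) \<noteq> 0" using c by simp
  have "integrable lborel (\<lambda>x. ?F (0 + c * x))"
    using c by (intro lborel_integrable_real_affine *(1)) auto
  hence "integrable lborel (\<lambda>x. of_real c powr (s - 1) * (indicator {0<..} x *\<^sub>R ?g x))"
    unfolding F .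
  from integrable_mult_right[OF this, of "inverse (of_real c powr (s - 1))"]
  have "integrable lborel (\<lambda>x. indicator {0<..} x *\<^sub>R ?g x)"
    using c0 by (simp only: mult.assoc[symmetric] left_inverse mult_1_left not_False_eq_True)
  thus ?A by (simp add: integrable_lborel_pos_iff set_integrable_def)
  have "Gamma s = \<bar>c\<bar> *\<^sub>R (\<integral>x. ?F (0 + c * x) \<partial>lborel)"
    using lborel_integral_real_affine[of c ?F 0] c *(2) by simp
  also have "\<dots> = (of_real c * of_real c powr (s - 1)) * (\<integral>x. indicator {0<..} x *\<^sub>R ?g x \<partial>lborel)"
    unfolding F using c by (simp add: scaleR_conv_of_real)
  also have "of_real c * of_real c powr (s - 1) = of_real c powr s"
    using c powr_add[of "of_real c" "s - 1" 1] by (simp add: powr_diff)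
  finally show ?B
    using c by (simp add: integral_lborel_pos_eq set_lebesgue_integral_def powr_minus field_simps)
qed

lemma integrable_powr_exp_pos:
  assumes "s > 0" "c > 0"
  shows "integrable lborel_pos (\<lambda>x. x powr (s - 1) * exp (- c * x))" (is ?A)
    and "(\<integral>x. x powr (s - 1) * exp (- c * x) \<partial>lborel_pos) = Gamma s * c powr (- s)" (is ?B)
proof -
  have eq: "complex_of_real x powr (of_real s - 1) * of_real (exp (- c * x)) =
              of_real (x powr (s - 1) * exp (- c * x))" if "x \<in> space lborel_pos" for x
    using that powr_of_real[of x "s - 1"] by (simp add: space_lborel_pos)
  note * = Gamma_scaled_integral_pos[of "of_real s" c]
  have "integrable lborel_pos (\<lambda>x. complex_of_real (x powr (s - 1) * exp (- c * x)))"
    using *(1) assms by (subst Bochner_Integration.integrable_cong[OF refl eq, symmetric]) auto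
  from integrable_bounded_linear[OF bounded_linear_Re this] show ?A by simp
  have "complex_of_real (\<integral>x. x powr (s - 1) * exp (- c * x) \<partial>lborel_pos) =
        (\<integral>x. complex_of_real x powr (of_real s - 1) * of_real (exp (- c * x)) \<partial>lborel_pos)"
    by (subst Bochner_Integration.integral_cong[OF refl eq])
      (simp_all only: integral_complex_of_real)
  also have "\<dots> = Gamma (of_real s) * of_real c powr (- of_real s)"
    using *(2) assms by simp
  also have "\<dots> = of_real (Gamma s * c powr (- s))"
    using assms powr_of_real[of c "-s"] by (simp add: Gamma_complex_of_real)
  finally show ?B by (simp only: of_real_eq_iff)
qed

lemma Taylor_exp_0: "norm (exp w - 1) \<le> exp (norm w) * norm w" for w :: complex
proof -
  have "norm (exp w - 1) \<le> exp \<bar>Re w\<bar> * norm w" using Taylor_exp[of w 0] by simp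
  also have "\<dots> \<le> exp (norm w) * norm w"
    by (intro mult_right_mono) (auto simp: abs_Re_le_cmod)
  finally show ?thesis .
qed

text \<open>With \<open>L = ln x\<close> this dominates the difference quotients of
  \<open>x powr s\<close> in \<open>s\<close>. The factor \<open>\<bar>L\<bar>\<close> is absorbed
  by a second exponential, and the bound becomes a sum of the powers \<open>x powr (2 * e)\<close>
  and \<open>x powr (- 2 * e)\<close>, which merely shift the exponent of an integrand.\<close>

lemma exp_quotient_bound:
  fixes h :: complex and L e :: real
  assumes "h \<noteq> 0" "norm h < e"
  shows "norm ((exp (h * of_real L) - 1) / h) \<le> (exp (2 * e * L) + exp (- 2 * e * L)) / e"
proof -
  have e: "e > 0" using assms norm_ge_zero[of h] by linarith
  have "norm ((exp (h * of_real L) - 1) / h) \<le> exp (norm h * \<bar>L\<bar>) * \<bar>L\<bar>"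
    using Taylor_exp_0[of "h * of_real L"] assms(1)
    by (simp add: norm_divide norm_mult divide_simps mult_ac)
  also have "\<dots> \<le> exp (e * \<bar>L\<bar>) * (exp (e * \<bar>L\<bar>) / e)"
  proof (intro mult_mono)
    show "exp (norm h * \<bar>L\<bar>) \<le> exp (e * \<bar>L\<bar>)"
      using assms(2) by (auto intro: mult_right_mono)
    have "e * \<bar>L\<bar> \<le> exp (e * \<bar>L\<bar>)"
      using exp_ge_add_one_self[of "e * \<bar>L\<bar>"] by linarith
    thus "\<bar>L\<bar> \<le> exp (e * \<bar>L\<bar>) / e" using e by (simp add: field_simps)
  qed auto
  also have "\<dots> = exp (2 * e * \<bar>L\<bar>) / e"
    by (simp add: exp_add[symmetric] algebra_simps)
  also have "exp (2 * e * \<bar>L\<bar>) \<le> exp (2 * e * L) + exp (- 2 * e * L)"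
    by (cases "L \<ge> 0") (auto simp: abs_if)
  finally show ?thesis using e by (simp add: divide_right_mono)
qed

text \<open>Order \<open>p\<close> at 0 together with exponential decay at infinity makes the Mellin
  integral converge, and be holomorphic, for \<open>Re s > - p\<close>.\<close>

locale mellin_bounded =
  fixes f :: "real \<Rightarrow> complex" and C p c :: real
  assumes cont: "continuous_on {0<..} f"
    and c_pos: "c > 0"
    and bound: "\<And>x. x > 0 \<Longrightarrow> norm (f x) \<le> C * x powr p * exp (- c * x)"
begin

lemma cont_integrand: "continuous_on {0<..} (\<lambda>x. f x * of_real x powr (s - 1))"
  by (intro continuous_intros cont) auto

lemma norm_integrand_le:
  assumes "x > 0"
  shows "norm (f x * of_real x powr (s - 1)) \<le> C * (x powr (p + Re s - 1) * exp (- c * x))"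
proof -
  have "norm (f x * of_real x powr (s - 1)) = norm (f x) * x powr (Re s - 1)"
    using assms by (simp add: norm_mult norm_powr_real_powr)
  also have "\<dots> \<le> C * x powr p * exp (- c * x) * x powr (Re s - 1)"
    by (intro mult_right_mono bound assms) auto
  also have "\<dots> = C * ((x powr p * x powr (Re s - 1)) * exp (- c * x))" by simp
  also have "x powr p * x powr (Re s - 1) = x powr (p + Re s - 1)"
    by (simp add: powr_add[symmetric] add_diff_eq)
  finally show ?thesis .
qed

lemma integrable_mellin:
  assumes "Re s > - p"
  shows "integrable lborel_pos (\<lambda>x. f x * of_real x powr (s - 1))"
proof (rule Bochner_Integration.integrable_bound)
  show "integrable lborel_pos (\<lambda>x. C * (x powr (p + Re s - 1) * exp (- c * x)))"
    using assms c_pos by (intro integrable_mult_right integrable_powr_exp_pos) auto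
  show "(\<lambda>x. f x * of_real x powr (s - 1)) \<in> borel_measurable lborel_pos"
    by (intro measurable_lborel_pos cont_integrand)
  show "AE x in lborel_pos. norm (f x * of_real x powr (s - 1))
          \<le> norm (C * (x powr (p + Re s - 1) * exp (- c * x)))"
    using norm_integrand_le[of _ s]
    by (intro AE_I2) (force simp: space_lborel_pos intro: order_trans[OF _ abs_ge_self])
qed

lemma C_nonneg: "C \<ge> 0"
  using bound[of 1] norm_ge_zero[of "f 1"]
  by (metis exp_gt_zero mult_1_right order_trans powr_one_eq_one zero_le_mult_iff zero_less_one not_less)

text \<open>Differentiation under the integral sign, by dominated convergence along sequences
  tending to \<open>s\<close>.\<close>

lemma mellin_has_field_derivative:
  assumes s: "Re s > - p"
  shows "(mellin f has_field_derivative
            (\<integral>x. f x * of_real (ln x) * of_real x powr (s - 1) \<partial>lborel_pos)) (at s)"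
proof -
  \<comment> \<open>The dominating function shifts the exponent by \<open>2 * e\<close> in both
    directions. A third of the distance to the boundary line leaves
    \<open>p + Re s - 2 * e = e > 0\<close>, so it stays integrable.\<close>
  define e where "e = (Re s + p) / 3"
  have e: "e > 0" using s by (simp add: e_def)
  let ?Q = "\<lambda>y x. (f x * of_real x powr (y - 1) - f x * of_real x powr (s - 1)) / (y - s)"
  let ?w = "\<lambda>x. C / e * (x powr (p + Re s + 2 * e - 1) * exp (- c * x) +
                            x powr (p + Re s - 2 * e - 1) * exp (- c * x))"
  have "((\<lambda>y. (mellin f y - mellin f s) / (y - s)) \<longlongrightarrow>
          (\<integral>x. f x * of_real (ln x) * of_real x powr (s - 1) \<partial>lborel_pos)) (at s within ball s e)"
    unfolding tendsto_at_iff_sequentially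
  proof (intro allI impI)
    fix X :: "nat \<Rightarrow> complex"
    assume X: "\<forall>i. X i \<in> ball s e - {s}" and Xlim: "X \<longlonglongrightarrow> s"
    have ReX: "Re (X i) > - p" for i
    proof -
      have "\<bar>Re (X i - s)\<bar> < e"
        using X[rule_format, of i] abs_Re_le_cmod[of "X i - s"] by (auto simp: dist_norm norm_minus_commute)
      thus ?thesis using s by (simp add: e_def field_simps abs_if split: if_splits)
    qed
    have "(\<lambda>i. (\<integral>x. ?Q (X i) x \<partial>lborel_pos)) \<longlonglongrightarrow>
          (\<integral>x. f x * of_real (ln x) * of_real x powr (s - 1) \<partial>lborel_pos)"
    proof (rule integral_dominated_convergence[where w = ?w])
      show "(\<lambda>x. f x * of_real (ln x) * of_real x powr (s - 1)) \<in> borel_measurable lborel_pos"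
        by (intro measurable_lborel_pos continuous_intros cont) auto
      show "?Q (X i) \<in> borel_measurable lborel_pos" for i
        using X by (intro measurable_lborel_pos continuous_intros cont) auto
      show "integrable lborel_pos ?w"
        using e c_pos s
        by (intro integrable_mult_right Bochner_Integration.integrable_add integrable_powr_exp_pos)
           (auto simp: e_def field_simps)
      show "AE x in lborel_pos. (\<lambda>i. ?Q (X i) x) \<longlonglongrightarrow>
              f x * of_real (ln x) * of_real x powr (s - 1)"
      proof (intro AE_I2)
        fix x assume "x \<in> space lborel_pos"
        hence x: "x > 0" by (simp add: space_lborel_pos)
        have "((\<lambda>y. f x * of_real x powr (y - 1)) has_field_derivative
                f x * of_real (ln x) * of_real x powr (s - 1)) (at s)"
          using x by (auto intro!: derivative_eq_intros simp: powr_def Ln_of_real)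
        hence "((\<lambda>y. ?Q y x) \<longlongrightarrow> f x * of_real (ln x) * of_real x powr (s - 1)) (at s)"
          by (simp add: has_field_derivative_iff)
        moreover have "filterlim X (at s) sequentially"
          using X Xlim by (auto simp: filterlim_at)
        ultimately show "(\<lambda>i. ?Q (X i) x) \<longlonglongrightarrow> f x * of_real (ln x) * of_real x powr (s - 1)"
          by (rule filterlim_compose)
      qed
      show "AE x in lborel_pos. norm (?Q (X i) x) \<le> ?w x" for i
      proof (intro AE_I2)
        fix x assume "x \<in> space lborel_pos"
        hence x: "x > 0" by (simp add: space_lborel_pos)
        define h where "h = X i - s"
        have h: "h \<noteq> 0" "norm h < e" using X by (auto simp: h_def dist_norm norm_minus_commute)
        have "?Q (X i) x = f x * of_real x powr (s - 1) * ((exp (h * of_real (ln x)) - 1) / h)"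
          using x h(1)
          by (simp add: powr_def Ln_of_real h_def field_simps exp_add[symmetric])
        hence "norm (?Q (X i) x) = norm (f x * of_real x powr (s - 1)) *
                 norm ((exp (h * of_real (ln x)) - 1) / h)"
          by (simp only: norm_mult)
        also have "\<dots> \<le> C * (x powr (p + Re s - 1) * exp (- c * x)) *
                 ((exp (2 * e * ln x) + exp (- 2 * e * ln x)) / e)"
          using C_nonneg by (intro mult_mono norm_integrand_le x exp_quotient_bound h) auto
        also have "\<dots> = ?w x"
          using x by (simp add: powr_def field_simps exp_add[symmetric] exp_diff[symmetric])
        finally show "norm (?Q (X i) x) \<le> ?w x" .
      qed
    qed
    also have "(\<lambda>i. (\<integral>x. ?Q (X i) x \<partial>lborel_pos)) =
                 (\<lambda>y. (mellin f y - mellin f s) / (y - s)) \<circ> X"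
      using integrable_mellin[OF s] integrable_mellin[OF ReX] by (simp add: fun_eq_iff mellin_def)
    finally show "((\<lambda>y. (mellin f y - mellin f s) / (y - s)) \<circ> X) \<longlonglongrightarrow>
          (\<integral>x. f x * of_real (ln x) * of_real x powr (s - 1) \<partial>lborel_pos)" .
  qed
  thus ?thesis
    using e by (simp add: has_field_derivative_iff at_within_open[of s "ball s e"])
qed

lemma holomorphic_mellin: "mellin f holomorphic_on {s. Re s > - p}"
  using mellin_has_field_derivative
  by (auto simp: holomorphic_on_def field_differentiable_def intro: has_field_derivative_at_within)

end

section \<open>Gamma integrals to the left of the imaginary axis\<close>

lemma integrable_min_powr:
  assumes "p > -1" "q < -1"
  shows "integrable lborel_pos (\<lambda>x. min (x powr p) (x powr q))"
proof -
  have meas: "(\<lambda>x. x powr r) \<in> borel_measurable lborel" for r :: real by measurable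
  have 1: "set_integrable lborel {0..1} (\<lambda>x::real. x powr p)"
  proof -
    have "(\<lambda>x. x powr p) absolutely_integrable_on {0..1}"
      using has_integral_powr_from_0[OF assms(1), of 1]
      by (intro nonnegative_absolutely_integrable_1) (auto simp: integrable_on_def)
    thus ?thesis
      unfolding set_integrable_def by (subst (asm) integrable_completion) measurable
  qed
  have 2: "set_integrable lborel {1..} (\<lambda>x::real. x powr q)"
  proof -
    have "(\<lambda>x. x powr q) absolutely_integrable_on {1..}"
      using has_integral_powr_to_inf[OF assms(2), of 1]
      by (intro nonnegative_absolutely_integrable_1) (auto simp: integrable_on_def)
    thus ?thesis
      unfolding set_integrable_def by (subst (asm) integrable_completion) measurable
  qed
  have "integrable lborel (\<lambda>x. indicator {0..1} x *\<^sub>R x powr p + indicator {1..} x *\<^sub>R x powr q)"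
    using 1 2 unfolding set_integrable_def by (rule Bochner_Integration.integrable_add)
  hence "integrable lborel (\<lambda>x. indicator {0<..} x *\<^sub>R min (x powr p) (x powr q))"
    by (rule Bochner_Integration.integrable_bound) (measurable, auto simp: indicator_def)
  thus ?thesis by (simp add: integrable_lborel_pos_iff set_integrable_def)
qed

text \<open>The two upper bounds on \<open>u\<close> control the two ends:
  \<open>u x * x powr s\<close> is at most \<open>x powr (m + 1 + s)\<close>, which tends to 0 at 0,
  and at most \<open>x powr (m + s)\<close>, which tends to 0 at infinity. So the boundary terms
  vanish exactly in the strip between \<open>- m - 1\<close> and \<open>- m\<close>.\<close>

lemma integral_by_parts_powr:
  fixes u u' :: "real \<Rightarrow> real"
  assumes s: "- m - 1 < s" "s < - m" "s \<noteq> 0"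
    and deriv: "\<And>x. x > 0 \<Longrightarrow> (u has_real_derivative u' x) (at x)"
    and cont: "continuous_on {0<..} u'"
    and u: "\<And>x. x > 0 \<Longrightarrow> 0 \<le> u x" "\<And>x. x > 0 \<Longrightarrow> u x \<le> x powr (m + 1)"
      "\<And>x. x > 0 \<Longrightarrow> u x \<le> x powr m"
    and int: "integrable lborel_pos (\<lambda>x. u' x * x powr s)"
  shows "integrable lborel_pos (\<lambda>x. u x * x powr (s - 1))" (is ?A)
    and "(\<integral>x. u x * x powr (s - 1) \<partial>lborel_pos) = - (\<integral>x. u' x * x powr s \<partial>lborel_pos) / s" (is ?B)
proof -
  have contu: "continuous_on {0<..} u"
    using deriv by (intro continuous_at_imp_continuous_on) (auto dest: DERIV_isCont)
  show A: ?A
  proof (rule Bochner_Integration.integrable_bound)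
    show "integrable lborel_pos (\<lambda>x. min (x powr (s + m)) (x powr (s + m - 1)))"
      using s by (intro integrable_min_powr) auto
    show "(\<lambda>x. u x * x powr (s - 1)) \<in> borel_measurable lborel_pos"
      by (intro measurable_lborel_pos continuous_intros contu) auto
    show "AE x in lborel_pos. norm (u x * x powr (s - 1)) \<le> norm (min (x powr (s + m)) (x powr (s + m - 1)))"
    proof (intro AE_I2)
      fix x assume "x \<in> space lborel_pos"
      hence x: "x > 0" by (simp add: space_lborel_pos)
      have "u x * x powr (s - 1) \<le> x powr (m + 1) * x powr (s - 1)"
        by (intro mult_right_mono u x) auto
      moreover have "u x * x powr (s - 1) \<le> x powr m * x powr (s - 1)"
        by (intro mult_right_mono u x) auto
      ultimately show "norm (u x * x powr (s - 1)) \<le> norm (min (x powr (s + m)) (x powr (s + m - 1)))"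
        using u(1)[OF x] by (simp add: powr_add[symmetric] algebra_simps)
    qed
  qed
  let ?F = "\<lambda>x. u x * x powr s"
  let ?f = "\<lambda>x. u' x * x powr s + s * (u x * x powr (s - 1))"
  have ein: "einterval 0 \<infinity> = {0<..}" by (auto simp: einterval_def)
  have intf: "integrable lborel_pos ?f"
    by (intro Bochner_Integration.integrable_add int integrable_mult_right A)
  have lim0: "(?F \<longlongrightarrow> 0) (at_right 0)"
  proof (rule tendsto_sandwich[of "\<lambda>_. 0" _ _ "\<lambda>x. x powr (m + 1 + s)"])
    show "((\<lambda>x. x powr (m + 1 + s)) \<longlongrightarrow> 0) (at_right 0)"
      using s by (intro tendsto_eq_intros) (auto simp: filterlim_at eventually_at_right_less intro!: tendsto_eq_intros eventually_at_right_less[THEN eventually_mono])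
    show "eventually (\<lambda>x. ?F x \<le> x powr (m + 1 + s)) (at_right 0)"
      using eventually_at_right_less[of "0::real"]
      by eventually_elim (use u(2) in \<open>auto simp: powr_add intro!: mult_right_mono\<close>)
    show "eventually (\<lambda>x. 0 \<le> ?F x) (at_right 0)"
      using eventually_at_right_less[of "0::real"] by eventually_elim (use u(1) in auto)
  qed auto
  have lim_inf: "(?F \<longlongrightarrow> 0) at_top"
  proof (rule tendsto_sandwich[of "\<lambda>_. 0" _ _ "\<lambda>x. x powr (m + s)"])
    show "((\<lambda>x. x powr (m + s)) \<longlongrightarrow> 0) at_top"
      using s by (intro tendsto_neg_powr filterlim_ident) auto
    show "eventually (\<lambda>x. ?F x \<le> x powr (m + s)) at_top"
      using eventually_gt_at_top[of 0]
      by eventually_elim (use u(3) in \<open>auto simp: powr_add intro!: mult_right_mono\<close>)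
    show "eventually (\<lambda>x. 0 \<le> ?F x) at_top"
      using eventually_gt_at_top[of 0] by eventually_elim (use u(1) in auto)
  qed auto
  have "(LBINT x=0..\<infinity>. ?f x) = 0 - 0"
  proof (rule interval_integral_FTC_integrable[where F = ?F])
    show "(?F has_vector_derivative ?f x) (at x)" if "0 < ereal x" "ereal x < \<infinity>" for x
      using that deriv[of x]
      by (auto intro!: derivative_eq_intros simp: has_real_derivative_iff_has_vector_derivative[symmetric])
    show "isCont ?f x" if "0 < ereal x" "ereal x < \<infinity>" for x
    proof -
      have "continuous_on {0<..} ?f" by (intro continuous_intros cont contu) auto
      thus ?thesis using that by (simp add: continuous_on_eq_continuous_at)
    qed
    show "set_integrable lborel (einterval 0 \<infinity>) ?f"
      using intf by (simp only: integrable_lborel_pos_iff ein)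
    show "((?F \<circ> real_of_ereal) \<longlongrightarrow> 0) (at_right 0)"
      using lim0 by (simp add: zero_ereal_def ereal_tendsto_simps1)
    show "((?F \<circ> real_of_ereal) \<longlongrightarrow> 0) (at_left \<infinity>)"
      using lim_inf by (simp add: ereal_tendsto_simps1)
  qed simp
  hence "(\<integral>x. ?f x \<partial>lborel_pos) = 0"
    by (simp add: interval_lebesgue_integral_def ein integral_lborel_pos_eq)
  hence "(\<integral>x. u' x * x powr s \<partial>lborel_pos) + s * (\<integral>x. u x * x powr (s - 1) \<partial>lborel_pos) = 0"
    using int A by (subst (asm) Bochner_Integration.integral_add) auto
  thus ?B using s by (simp add: field_simps)
qed

lemma not_nonpos_Ints_between:
  fixes s :: real
  assumes "of_int k < s" "s < of_int (k + 1)"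
  shows "s \<notin> \<int>\<^sub>\<le>\<^sub>0"
proof
  assume "s \<in> \<int>\<^sub>\<le>\<^sub>0"
  then obtain n where "s = of_int n" by (elim nonpos_Ints_cases)
  with assms have "k < n" "n < k + 1" by (simp_all only: of_int_less_iff)
  thus False by simp
qed

text \<open>Integration by parts with \<open>m = 0\<close> turns the integral into the one for
  \<open>Gamma (s + 1)\<close>, where \<open>s + 1 > 0\<close>; the functional equation then gives
  \<open>Gamma s\<close>.\<close>

lemma Gamma_integral_subtract1:
  fixes s :: real
  assumes "-1 < s" "s < 0"
  shows "integrable lborel_pos (\<lambda>x. (1 - exp (- x)) * x powr (s - 1))"
    and "(\<integral>x. (1 - exp (- x)) * x powr (s - 1) \<partial>lborel_pos) = - Gamma s"
proof -
  have int: "integrable lborel_pos (\<lambda>x. exp (- x) * x powr s)"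
    and val: "(\<integral>x. exp (- x) * x powr s \<partial>lborel_pos) = Gamma (s + 1)"
    using integrable_powr_exp_pos[of "s + 1" 1] assms by (simp_all add: mult.commute)
  have "1 - exp (- x) \<le> x" for x :: real
    using exp_ge_add_one_self[of "-x"] by simp
  hence le: "1 - exp (- x) \<le> x powr (0 + 1)" "1 - exp (- x) \<le> x powr 0" if "x > 0" for x :: real
    using that by auto
  note * = integral_by_parts_powr[of 0 s "\<lambda>x. 1 - exp (- x)" "\<lambda>x. exp (- x)", OF _ _ _ _ _ _ le int]
  show "integrable lborel_pos (\<lambda>x. (1 - exp (- x)) * x powr (s - 1))"
    using assms by (intro *) (auto intro!: derivative_eq_intros continuous_intros)
  have "(\<integral>x. (1 - exp (- x)) * x powr (s - 1) \<partial>lborel_pos) = - Gamma (s + 1) / s"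
    unfolding val[symmetric] using assms by (intro *) (auto intro!: derivative_eq_intros continuous_intros)
  also have "\<dots> = - Gamma s"
  proof -
    have "s \<notin> \<int>\<^sub>\<le>\<^sub>0"
      using assms by (intro not_nonpos_Ints_between[of "-1"]) auto
    thus ?thesis using assms Gamma_plus1[of s] by auto
  qed
  finally show "(\<integral>x. (1 - exp (- x)) * x powr (s - 1) \<partial>lborel_pos) = - Gamma s" .
qed

text \<open>The same reduction once more, with \<open>m = 1\<close>, to the previous lemma at
  \<open>s + 1\<close>.\<close>

lemma Gamma_integral_subtract2:
  fixes s :: real
  assumes "-2 < s" "s < -1"
  shows "integrable lborel_pos (\<lambda>x. (exp (- x) - 1 + x) * x powr (s - 1))"
    and "(\<integral>x. (exp (- x) - 1 + x) * x powr (s - 1) \<partial>lborel_pos) = Gamma s"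
proof -
  have int: "integrable lborel_pos (\<lambda>x. (1 - exp (- x)) * x powr s)"
    and val: "(\<integral>x. (1 - exp (- x)) * x powr s \<partial>lborel_pos) = - Gamma (s + 1)"
    using Gamma_integral_subtract1[of "s + 1"] assms by simp_all
  \<comment> \<open>After multiplication by \<open>1 + x\<close> the claim
    \<open>exp (- x) \<le> 1 - x + x\<^sup>2\<close> compares a left side of at most 1 with
    \<open>1 + x ^ 3\<close>.\<close>
  have le1: "exp (- x) - 1 + x \<le> x powr (1 + 1)" if "x > 0" for x :: real
  proof -
    have "exp (- x) * (1 + x) \<le> exp (- x) * exp x"
      by (intro mult_left_mono exp_ge_add_one_self) auto
    also have "\<dots> \<le> (1 - x + x\<^sup>2) * (1 + x)"
      using that by (simp add: exp_add[symmetric] algebra_simps power2_eq_square)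
    finally have "exp (- x) \<le> 1 - x + x\<^sup>2"
      using that by (subst (asm) mult_le_cancel_right_pos) auto
    thus ?thesis using that by (simp add: powr_numeral)
  qed
  have le2: "exp (- x) - 1 + x \<le> x powr 1" if "x > 0" for x :: real
    using that by simp
  have nn: "0 \<le> exp (- x) - 1 + x" for x :: real
    using exp_ge_add_one_self[of "-x"] by simp
  note * = integral_by_parts_powr[of 1 s "\<lambda>x. exp (- x) - 1 + x" "\<lambda>x. 1 - exp (- x)", OF _ _ _ _ _ nn le1 le2 int]
  show "integrable lborel_pos (\<lambda>x. (exp (- x) - 1 + x) * x powr (s - 1))"
    using assms by (intro *) (auto intro!: derivative_eq_intros continuous_intros)
  have "(\<integral>x. (exp (- x) - 1 + x) * x powr (s - 1) \<partial>lborel_pos) = - (- Gamma (s + 1)) / s"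
    unfolding val[symmetric] using assms by (intro *) (auto intro!: derivative_eq_intros continuous_intros)
  also have "\<dots> = Gamma s"
  proof -
    have "s \<notin> \<int>\<^sub>\<le>\<^sub>0"
      using assms by (intro not_nonpos_Ints_between[of "-2"]) auto
    thus ?thesis using assms Gamma_plus1[of s] by auto
  qed
  finally show "(\<integral>x. (exp (- x) - 1 + x) * x powr (s - 1) \<partial>lborel_pos) = Gamma s" .
qed

section \<open>The analytic continuation\<close>

text \<open>The series splits into its polynomial part and \<open>fps_shift N F\<close> times
  \<open>fps_X ^ N\<close>. The shifted series tends to the coefficient of index \<open>N\<close>,
  so near 0 it is bounded by the norm of that coefficient plus 1.\<close>

lemma has_fps_expansion_Taylor_bound:
  fixes f :: "complex \<Rightarrow> complex"
  assumes "f has_fps_expansion F"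
  shows "\<exists>K. eventually (\<lambda>w. norm (f w - (\<Sum>k<N. fps_nth F k * w ^ k)) \<le> K * norm w ^ N) (nhds 0)"
proof -
  let ?h = "eval_fps (fps_shift N F)"
  have r: "fps_conv_radius F > 0" and f: "eventually (\<lambda>w. eval_fps F w = f w) (nhds 0)"
    using assms by (auto simp: has_fps_expansion_def)
  have h: "?h has_fps_expansion fps_shift N F"
    using r by (intro eval_fps_has_fps_expansion) simp
  have "F = (\<Sum>k<N. fps_const (fps_nth F k) * fps_X ^ k) + fps_shift N F * fps_X ^ N"
    by (rule fps_ext) (auto simp: fps_sum_nth fps_X_power_mult_right_nth if_distrib sum.delta cong: if_cong)
  moreover have "(\<lambda>w. (\<Sum>k<N. fps_nth F k * w ^ k) + ?h w * w ^ N) has_fps_expansion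
          ((\<Sum>k<N. fps_const (fps_nth F k) * fps_X ^ k) + fps_shift N F * fps_X ^ N)"
    by (intro fps_expansion_intros h)
  ultimately have "(\<lambda>w. (\<Sum>k<N. fps_nth F k * w ^ k) + ?h w * w ^ N) has_fps_expansion F"
    by metis
  hence "eventually (\<lambda>w. eval_fps F w = (\<Sum>k<N. fps_nth F k * w ^ k) + ?h w * w ^ N) (nhds 0)"
    by (simp add: has_fps_expansion_def)
  moreover have "eventually (\<lambda>w. dist (?h w) (fps_nth (fps_shift N F) 0) < 1) (nhds 0)"
    using has_fps_expansion_imp_tendsto_0[OF h] tendstoD zero_less_one by blast
  ultimately have "eventually (\<lambda>w. norm (f w - (\<Sum>k<N. fps_nth F k * w ^ k)) \<le>
                     (norm (fps_nth F N) + 1) * norm w ^ N) (nhds 0)"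
    using f
  proof eventually_elim
    case (elim w)
    have "norm (?h w) \<le> norm (fps_nth F N) + 1"
      using elim(2) norm_triangle_sub[of "?h w" "fps_nth F N"] by (simp add: dist_norm)
    moreover have "f w - (\<Sum>k<N. fps_nth F k * w ^ k) = ?h w * w ^ N"
      using elim by simp
    ultimately show ?case by (simp add: norm_mult norm_power mult_right_mono)
  qed
  thus ?thesis by blast
qed

section \<open>The kernel and the Dirichlet series as its Mellin transform\<close>

locale hurwitz_lerch_params =
  fixes a :: real and z :: complex
  assumes a_pos: "0 < a" and a_le_1: "a \<le> 1" and z_le_1: "norm z \<le> 1"
begin

definition ker :: "real \<Rightarrow> complex" where
  "ker x = of_real (x * exp (- a * x)) / (1 - z * of_real (exp (- x)))"

lemma norm_denominator_ge:
  assumes "x > 0"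
  shows "norm (1 - z * of_real (exp (- x))) \<ge> 1 - exp (- x)"
proof -
  have "norm (z * of_real (exp (- x))) \<le> exp (- x)"
    using z_le_1 by (simp add: norm_mult mult_left_le_one_le)
  thus ?thesis using norm_triangle_ineq2[of 1 "z * of_real (exp (- x))"] by simp
qed

lemma denominator_nonzero:
  assumes "x > 0"
  shows "1 - z * of_real (exp (- x)) \<noteq> 0"
  using norm_denominator_ge[OF assms] assms by (auto simp del: of_real_exp)

lemma continuous_on_ker: "continuous_on {0<..} ker"
  unfolding ker_def
  by (intro continuous_intros) (use denominator_nonzero in auto)

lemma norm_ker_le:
  assumes "x > 0" "d > 0" "d \<le> x"
  shows "norm (ker x) \<le> x * exp (- a * x) / (1 - exp (- d))"
proof -
  have "1 - exp (- d) \<le> norm (1 - z * of_real (exp (- x)))"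
    using norm_denominator_ge[of x] assms by (smt (verit) exp_le_cancel_iff)
  thus ?thesis
    using assms unfolding ker_def norm_divide
    by (intro frac_le) (auto simp: norm_mult)
qed

lemma summable_powr_neg:
  assumes "\<sigma> > 1"
  shows "summable (\<lambda>n. (real n + a) powr (- \<sigma>))"
proof (rule summable_comparison_test_ev)
  show "summable (\<lambda>n. real n powr (- \<sigma>))"
    using assms by (simp add: summable_real_powr_iff)
  show "eventually (\<lambda>n. norm ((real n + a) powr (- \<sigma>)) \<le> real n powr (- \<sigma>)) sequentially"
    using eventually_gt_at_top[of 0] 
    by eventually_elim (use a_pos assms in \<open>auto intro!: powr_mono2'\<close>)
qed

text \<open>The geometric series of the kernel is integrated term by term, each term giving
  \<open>Gamma s\<close> times a term of the Dirichlet series. The exchange is allowed because the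
  integrals of the norms are at most \<open>Gamma (Re s) * (real n + a) powr (- Re s)\<close>, which
  is summable. The argument is \<open>s - 1\<close> because the kernel carries an extra factor
  \<open>x\<close>.\<close>

lemma mellin_ker_sums:
  assumes s: "Re s > 1"
  shows "(\<lambda>n. z ^ n * of_real (real n + a) powr (- s)) sums (rGamma s * mellin ker (s - 1))"
proof -
  let ?f = "\<lambda>n x. z ^ n * (of_real x powr (s - 1) * of_real (exp (- (real n + a) * x)))"
  have na: "real n + a > 0" for n using a_pos by simp
  have s0: "Re s > 0" using s by simp
  have int: "integrable lborel_pos (?f n)" for n
    by (intro integrable_mult_right Gamma_scaled_integral_pos(1) s0 na)
  have val: "(\<integral>x. ?f n x \<partial>lborel_pos) = z ^ n * (Gamma s * of_real (real n + a) powr (- s))" for n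
    using Gamma_scaled_integral_pos[OF s0 na[of n]] by (subst Bochner_Integration.integral_mult_right) auto
  have sums: "(\<lambda>n. ?f n x) sums (ker x * of_real x powr (s - 1 - 1))"
    and summ: "summable (\<lambda>n. norm (?f n x))" if "x \<in> space lborel_pos" for x
  proof -
    from that have x: "x > 0" by (simp add: space_lborel_pos)
    let ?q = "z * of_real (exp (- x))"
    have q: "norm ?q < 1"
    proof -
      have "norm ?q \<le> exp (- x)"
        using z_le_1 by (simp add: norm_mult mult_left_le_one_le)
      also have "\<dots> < 1" using x by simp
      finally show ?thesis .
    qed
    have eq: "?f n x = of_real x powr (s - 1) * of_real (exp (- a * x)) * ?q ^ n" for n
      by (simp add: power_mult_distrib exp_of_nat_mult[symmetric] exp_add[symmetric] ring_distribs
          exp_minus field_simps flip: exp_of_real of_real_power)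
    have "(\<lambda>n. of_real x powr (s - 1) * of_real (exp (- a * x)) * ?q ^ n) sums
            (of_real x powr (s - 1) * of_real (exp (- a * x)) * (1 / (1 - ?q)))"
      by (intro sums_mult geometric_sums q)
    also have "of_real x powr (s - 1) * of_real (exp (- a * x)) * (1 / (1 - ?q)) =
                 ker x * of_real x powr (s - 1 - 1)"
    proof -
      have "of_real x powr (s - 1 - 1) = of_real x powr (s - 1) / of_real x"
        using x powr_diff[of "of_real x" "s - 1" 1] by simp
      thus ?thesis using x by (simp add: ker_def)
    qed
    finally show "(\<lambda>n. ?f n x) sums (ker x * of_real x powr (s - 1 - 1))"
      unfolding eq .
    show "summable (\<lambda>n. norm (?f n x))"
      unfolding eq norm_mult[of _ "?q ^ _"] norm_power using q
      by (intro summable_mult summable_geometric) simp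
  qed
  have norm_le: "(\<integral>x. norm (?f n x) \<partial>lborel_pos) \<le> Gamma (Re s) * (real n + a) powr (- Re s)" for n
  proof -
    have "(\<integral>x. norm (?f n x) \<partial>lborel_pos) =
            (\<integral>x. norm z ^ n * (x powr (Re s - 1) * exp (- (real n + a) * x)) \<partial>lborel_pos)"
      by (intro Bochner_Integration.integral_cong refl)
         (simp add: space_lborel_pos norm_mult norm_power norm_powr_real_powr flip: exp_of_real)
    also have "\<dots> = norm z ^ n * (Gamma (Re s) * (real n + a) powr (- Re s))"
      using integrable_powr_exp_pos[OF s0 na[of n]] by (subst Bochner_Integration.integral_mult_right) auto
    also have "\<dots> \<le> 1 * (Gamma (Re s) * (real n + a) powr (- Re s))"
      using z_le_1 Gamma_real_pos[OF s0]
      by (intro mult_right_mono power_le_one mult_nonneg_nonneg) auto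
    finally show ?thesis by simp
  qed
  have "(\<lambda>n. \<integral>x. ?f n x \<partial>lborel_pos) sums (\<integral>x. (\<Sum>n. ?f n x) \<partial>lborel_pos)"
  proof (rule sums_integral[OF int])
    show "AE x in lborel_pos. summable (\<lambda>n. norm (?f n x))" using summ by (rule AE_I2)
    show "summable (\<lambda>n. \<integral>x. norm (?f n x) \<partial>lborel_pos)"
    proof (rule summable_comparison_test_ev)
      show "summable (\<lambda>n. Gamma (Re s) * (real n + a) powr (- Re s))"
        by (intro summable_mult summable_powr_neg s)
    qed (use norm_le in \<open>auto simp: abs_of_nonneg\<close>)
  qed
  also have "(\<integral>x. (\<Sum>n. ?f n x) \<partial>lborel_pos) = mellin ker (s - 1)"
    unfolding mellin_def using sums
    by (intro Bochner_Integration.integral_cong refl) (simp add: sums_iff)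
  finally have "(\<lambda>n. rGamma s * (z ^ n * (Gamma s * of_real (real n + a) powr (- s)))) sums
                  (rGamma s * mellin ker (s - 1))"
    unfolding val by (rule sums_mult)
  moreover have "s \<notin> \<int>\<^sub>\<le>\<^sub>0"
    using s0 by (auto elim!: nonpos_Ints_cases)
  hence "rGamma s * Gamma s = 1"
    by (simp add: rGamma_inverse_Gamma Gamma_eq_zero_iff)
  hence "rGamma s * (z ^ n * (Gamma s * w)) = z ^ n * w" for n w
    by (metis mult.assoc mult.commute mult_1_left)
  ultimately show ?thesis by simp
qed

section \<open>Taylor coefficients of the kernel at 0\<close>

definition ker_fps :: "complex fps" where
  "ker_fps = (fps_X * fps_exp (1 - of_real a)) / (1 - fps_const z * fps_exp (- 1))"

text \<open>The numerator has order 1 and the denominator order 1 or 0 according to whether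
  \<open>z = 1\<close>, so the quotient of formal series is an exact division in both cases.\<close>

lemma ker_fps_aux:
  defines "D \<equiv> 1 - fps_const z * fps_exp (- 1)"
  shows "D \<noteq> 0" "subdegree D \<le> 1" "subdegree D = 1 \<longleftrightarrow> z = 1"
    "subdegree (fps_X * fps_exp (1 - complex_of_real a)) = 1"
proof -
  have D: "fps_nth D 0 = 1 - z" "fps_nth D 1 = z"
    by (simp_all add: D_def)
  show "D \<noteq> 0" using D by (metis fps_zero_nth right_minus_eq zero_neq_one)
  have "subdegree D = (if z = 1 then 1 else 0)"
    using D by (auto intro!: subdegreeI)
  thus "subdegree D \<le> 1" "subdegree D = 1 \<longleftrightarrow> z = 1" by auto
  show "subdegree (fps_X * fps_exp (1 - complex_of_real a)) = 1"
    by (rule subdegreeI) auto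
qed

lemma has_fps_expansion_ker:
  "(\<lambda>w. if w = 0 then fps_nth ker_fps 0
         else w * exp ((1 - of_real a) * w) / (1 - z * exp (- w))) has_fps_expansion ker_fps"
proof -
  let ?N = "fps_X * fps_exp (1 - complex_of_real a)" and ?D = "1 - fps_const z * fps_exp (- 1)"
  have *: "(\<lambda>w. if w = 0 then c else w * exp ((1 - of_real a) * w) / (1 - z * exp (- w)))
          has_fps_expansion ker_fps" if "c = fps_nth ?N (subdegree ?D) / fps_nth ?D (subdegree ?D)" for c
    unfolding ker_fps_def using ker_fps_aux that
    by (intro has_fps_expansion_divide) (auto intro!: fps_expansion_intros has_fps_expansion_exp_neg1)
  show ?thesis
    \<comment> \<open>The division rule dictates the value at 0 as a quotient of coefficients. A
      function with an expansion takes the constant coefficient at 0, so that value is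
      \<open>fps_nth ker_fps 0\<close>.\<close>
    using *[OF refl] has_fps_expansion_imp_0_eq_fps_nth_0[OF *[OF refl]] by (simp only: if_True refl)
qed

lemma ker_fps_mult:
  "ker_fps * (1 - fps_const z * fps_exp (- 1)) = fps_X * fps_exp (1 - of_real a)"
  unfolding ker_fps_def using ker_fps_aux
  by (intro dvd_div_mult_self) (auto simp: fps_dvd_iff)

lemma ker_fps_nth_neq_1:
  assumes "z \<noteq> 1"
  shows "fps_nth ker_fps 0 = 0" "fps_nth ker_fps 1 = 1 / (1 - z)"
    "fps_nth ker_fps 2 = (1 - of_real a) / (1 - z) - z / (1 - z)\<^sup>2"
proof -
  let ?Q = "fps_nth ker_fps"
  have eq: "fps_nth (ker_fps * (1 - fps_const z * fps_exp (- 1))) n =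
            fps_nth (fps_X * fps_exp (1 - of_real a)) n" for n
    by (simp only: ker_fps_mult)
  have 0: "?Q 0 * (1 - z) = 0"
    using eq[of 0] by (simp add: fps_mult_nth)
  thus Q0: "?Q 0 = 0" using assms by simp
  have 1: "?Q 1 * (1 - z) = 1"
    using eq[of 1] Q0 by (simp add: fps_mult_nth)
  thus Q1: "?Q 1 = 1 / (1 - z)" using assms by (simp add: field_simps)
  have 2: "?Q 2 * (1 - z) + ?Q 1 * z = 1 - of_real a"
    using eq[of 2] Q0 by (simp add: fps_mult_nth numeral_2_eq_2 add.commute)
  show "?Q 2 = (1 - of_real a) / (1 - z) - z / (1 - z)\<^sup>2"
  proof -
    have "?Q 2 * (1 - z) = (1 - of_real a) - z / (1 - z)"
      using 2 unfolding Q1 by (simp add: algebra_simps)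
    hence "?Q 2 = ((1 - of_real a) - z / (1 - z)) / (1 - z)"
      using assms by (simp add: eq_divide_eq)
    thus ?thesis by (simp add: diff_divide_distrib power2_eq_square)
  qed
qed

text \<open>For \<open>z = 1\<close> the denominator starts as X - X^2/2 + X^3/6, so the coefficient
  of index \<open>n + 1\<close> of the product determines the one of index \<open>n\<close> of the
  quotient. The results are the Bernoulli polynomials at \<open>2 - a\<close>, divided by
  factorials.\<close>

lemma ker_fps_nth_1:
  assumes "z = 1"
  shows "fps_nth ker_fps 0 = 1" "fps_nth ker_fps 1 = 3 / 2 - of_real a"
    "fps_nth ker_fps 2 = (1 - of_real a)\<^sup>2 / 2 + (1 - of_real a) / 2 + 1 / 12"
proof -
  let ?Q = "fps_nth ker_fps"
  have eq: "fps_nth (ker_fps * (1 - fps_const z * fps_exp (- 1))) n =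
            fps_nth (fps_X * fps_exp (1 - of_real a)) n" for n
    by (simp only: ker_fps_mult)
  show 0: "?Q 0 = 1"
    using eq[of 1] assms by (simp add: fps_mult_nth)
  have 1: "?Q 1 - ?Q 0 / 2 = 1 - of_real a"
    using eq[of 2] assms by (simp add: fps_mult_nth numeral_2_eq_2)
  thus Q1: "?Q 1 = 3 / 2 - of_real a" using 0 by (simp add: field_simps)
  have 2: "?Q 2 - ?Q 1 / 2 + ?Q 0 / 6 = (1 - of_real a)\<^sup>2 / 2"
    using eq[of 3] assms
    by (simp add: fps_mult_nth numeral_2_eq_2 numeral_3_eq_3 algebra_simps)
  show "?Q 2 = (1 - of_real a)\<^sup>2 / 2 + (1 - of_real a) / 2 + 1 / 12"
  proof -
    have "?Q 2 = (1 - of_real a)\<^sup>2 / 2 + ?Q 1 / 2 - ?Q 0 / 6"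
      unfolding 2[symmetric] by simp
    thus ?thesis unfolding Q1 0 by (simp add: diff_divide_distrib)
  qed
qed

section \<open>Damped Taylor remainders and their Mellin transforms\<close>

definition ker_rem :: "nat \<Rightarrow> real \<Rightarrow> complex" where
  "ker_rem N x = ker x - of_real (exp (- x)) * (\<Sum>k<N. fps_nth ker_fps k * of_real x ^ k)"

lemma ker_rem_0: "ker_rem 0 = ker"
  by (simp add: ker_rem_def fun_eq_iff)

lemma ker_rem_bound_near_0:
  "\<exists>K d. d > 0 \<and> (\<forall>x. 0 < x \<and> x < d \<longrightarrow> norm (ker_rem N x) \<le> K * x ^ N * exp (- x))"
proof -
  let ?q = "\<lambda>w. if w = 0 then fps_nth ker_fps 0
         else w * exp ((1 - of_real a) * w) / (1 - z * exp (- w))"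
  obtain K where "eventually (\<lambda>w. norm (?q w - (\<Sum>k<N. fps_nth ker_fps k * w ^ k)) \<le> K * norm w ^ N) (nhds 0)"
    using has_fps_expansion_Taylor_bound[OF has_fps_expansion_ker] by blast
  then obtain d where d: "d > 0" "\<And>w. norm w < d \<Longrightarrow>
      norm (?q w - (\<Sum>k<N. fps_nth ker_fps k * w ^ k)) \<le> K * norm w ^ N"
    by (auto simp: eventually_nhds_metric dist_norm)
  have "norm (ker_rem N x) \<le> K * x ^ N * exp (- x)" if x: "0 < x" "x < d" for x
  proof -
    have "of_real (exp (- a * x)) = of_real (exp (- x)) * exp ((1 - of_real a) * complex_of_real x)"
      by (simp add: exp_add[symmetric] algebra_simps flip: exp_of_real)
    hence "ker x = of_real (exp (- x)) * ?q (of_real x)"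
      unfolding ker_def of_real_mult using x by (simp flip: exp_of_real)
    hence "ker_rem N x = of_real (exp (- x)) * (?q (of_real x) - (\<Sum>k<N. fps_nth ker_fps k * of_real x ^ k))"
      unfolding ker_rem_def by (simp only: right_diff_distrib)
    hence "norm (ker_rem N x) = exp (- x) * norm (?q (of_real x) - (\<Sum>k<N. fps_nth ker_fps k * of_real x ^ k))"
      by (simp only: norm_mult norm_of_real abs_exp_cancel)
    also have "\<dots> \<le> exp (- x) * (K * norm (complex_of_real x) ^ N)"
      using x by (intro mult_left_mono d(2)) auto
    finally show ?thesis using x by (simp add: mult_ac)
  qed
  thus ?thesis using d(1) by blast
qed

text \<open>Near 0 the Taylor bound applies. Away from 0 only decay matters: replacing the rate
  \<open>a\<close> by \<open>a / 2\<close> absorbs the factor \<open>x\<close> of the kernel, and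
  powers of \<open>x / d\<close>, which are at least 1, raise every term to order
  \<open>N\<close>.\<close>

lemma ker_rem_bounded: "\<exists>C. mellin_bounded (ker_rem N) C N (a / 2)"
proof -
  obtain K d where d: "d > 0" and K: "\<And>x. 0 < x \<Longrightarrow> x < d \<Longrightarrow> norm (ker_rem N x) \<le> K * x ^ N * exp (- x)"
    using ker_rem_bound_near_0 by blast
  \<comment> \<open>\<open>A\<close> is the constant for the kernel on \<open>x \<ge> d\<close>,
    \<open>B\<close> the one for the subtracted damped polynomial there.\<close>
  define A where "A = 2 / a / (1 - exp (- d)) / d ^ N"
  define B where "B = (\<Sum>k<N. norm (fps_nth ker_fps k) / d ^ (N - k))"
  have AB: "A \<ge> 0" "B \<ge> 0"
    using d a_pos by (auto simp: A_def B_def intro!: sum_nonneg)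
  have exp_le: "exp (- x) \<le> exp (- (a / 2) * x)" if "x > 0" for x
    using that a_pos a_le_1 mult_right_mono[of "a / 2" 1 x] by simp
  have "norm (ker_rem N x) \<le> (\<bar>K\<bar> + A + B) * x powr N * exp (- (a / 2) * x)" if x: "x > 0" for x
  proof (cases "x < d")
    case True
    have "norm (ker_rem N x) \<le> K * x ^ N * exp (- x)" by (rule K[OF x True])
    also have "\<dots> \<le> \<bar>K\<bar> * x ^ N * exp (- (a / 2) * x)"
      using x by (intro mult_mono exp_le) auto
    also have "\<dots> \<le> (\<bar>K\<bar> + A + B) * x ^ N * exp (- (a / 2) * x)"
      using AB x by (intro mult_right_mono) auto
    finally show ?thesis using x by (simp add: powr_realpow)
  next
    case False
    hence xd: "x \<ge> d" by simp
    have dN: "1 \<le> x ^ n / d ^ n" for n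
      using power_mono[OF xd, of n] d by (simp add: field_simps)
    have k1: "norm (ker x) \<le> x * exp (- a * x) / (1 - exp (- d))"
      using x d xd by (rule norm_ker_le)
    have "x * exp (- a * x) \<le> 2 / a * exp (- (a / 2) * x) * 1"
    proof -
      have "a / 2 * x \<le> exp (a / 2 * x)"
        using exp_ge_add_one_self[of "a / 2 * x"] by linarith
      hence "x \<le> 2 / a * exp (a / 2 * x)" using a_pos by (simp add: field_simps)
      hence "x * exp (- a * x) \<le> 2 / a * exp (a / 2 * x) * exp (- a * x)"
        by (intro mult_right_mono) auto
      also have "\<dots> = 2 / a * exp (- (a / 2) * x)"
        by (simp add: exp_add[symmetric] mult.assoc)
      finally show ?thesis by simp
    qed
    also have "2 / a * exp (- (a / 2) * x) * 1 \<le> 2 / a * exp (- (a / 2) * x) * (x ^ N / d ^ N)"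
      using a_pos by (intro mult_left_mono dN) auto
    finally have "x * exp (- a * x) / (1 - exp (- d)) \<le>
        2 / a * exp (- (a / 2) * x) * (x ^ N / d ^ N) / (1 - exp (- d))"
      using d by (intro divide_right_mono) auto
    also have "\<dots> = A * x ^ N * exp (- (a / 2) * x)"
      by (simp add: A_def mult_ac)
    finally have 1: "norm (ker x) \<le> A * x ^ N * exp (- (a / 2) * x)"
      using k1 by (rule order_trans[rotated])
    have "norm (of_real (exp (- x)) * (\<Sum>k<N. fps_nth ker_fps k * of_real x ^ k))
            \<le> exp (- x) * (\<Sum>k<N. norm (fps_nth ker_fps k) * x ^ k)"
      unfolding norm_mult norm_of_real abs_exp_cancel
      using x by (intro mult_left_mono sum_norm_le) (auto simp: norm_mult norm_power)
    also have "\<dots> \<le> exp (- (a / 2) * x) * (\<Sum>k<N. norm (fps_nth ker_fps k) / d ^ (N - k) * x ^ N)"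
    proof (rule mult_mono[OF exp_le[OF x] sum_mono])
      fix k assume "k \<in> {..<N}"
      hence "x ^ N = x ^ k * x ^ (N - k)" by (simp flip: power_add)
      moreover have "x ^ k * 1 \<le> x ^ k * (x ^ (N - k) / d ^ (N - k))"
        using x by (intro mult_left_mono dN) auto
      ultimately have "x ^ k \<le> x ^ N / d ^ (N - k)" by simp
      from mult_left_mono[OF this, of "norm (fps_nth ker_fps k)"]
      show "norm (fps_nth ker_fps k) * x ^ k \<le> norm (fps_nth ker_fps k) / d ^ (N - k) * x ^ N"
        by simp
    qed (use x in \<open>auto intro!: sum_nonneg\<close>)
    also have "\<dots> = B * x ^ N * exp (- (a / 2) * x)"
      by (simp add: B_def sum_distrib_left mult_ac)
    finally have 2: "norm (of_real (exp (- x)) * (\<Sum>k<N. fps_nth ker_fps k * of_real x ^ k))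
        \<le> B * x ^ N * exp (- (a / 2) * x)" .
    have "norm (ker_rem N x) \<le> A * x ^ N * exp (- (a / 2) * x) + B * x ^ N * exp (- (a / 2) * x)"
      unfolding ker_rem_def using 1 2 by (intro order_trans[OF norm_triangle_ineq4] add_mono)
    also have "\<dots> = (A + B) * x ^ N * exp (- (a / 2) * x)" by (simp add: algebra_simps)
    also have "\<dots> \<le> (\<bar>K\<bar> + A + B) * x ^ N * exp (- (a / 2) * x)"
      using x by (intro mult_right_mono) auto
    finally show ?thesis using x by (simp add: powr_realpow)
  qed
  moreover have "continuous_on {0<..} (ker_rem N)"
    unfolding ker_rem_def by (intro continuous_intros continuous_on_ker)
  ultimately have "mellin_bounded (ker_rem N) (\<bar>K\<bar> + A + B) N (a / 2)"
    using a_pos by unfold_locales auto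
  thus ?thesis by blast
qed

lemma integrable_ker_rem:
  "Re s > - real N \<Longrightarrow> integrable lborel_pos (\<lambda>x. ker_rem N x * of_real x powr (s - 1))"
  using ker_rem_bounded[of N] mellin_bounded.integrable_mellin by blast

text \<open>
  Subtracting the Taylor polynomial of \<open>exp x * ker x\<close> damped by \<open>exp (- x)\<close> keeps the decay at
  infinity, and each subtracted term contributes \<open>\<Gamma>(s + k) / \<Gamma>(s)\<close>, a polynomial in \<open>s\<close>.
\<close>
definition psi_strip :: "nat \<Rightarrow> complex \<Rightarrow> complex" where
  "psi_strip N s = rGamma s * mellin (ker_rem N) s + (\<Sum>k<N. fps_nth ker_fps k * pochhammer s k)"

lemma holomorphic_psi_strip: "psi_strip N holomorphic_on {s. Re s > - real N}"
proof -
  have "mellin (ker_rem N) holomorphic_on {s. Re s > - real N}"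
    using ker_rem_bounded[of N] mellin_bounded.holomorphic_mellin by blast
  moreover have "(\<lambda>s. pochhammer s k) holomorphic_on A" for k and A :: "complex set"
    by (induction k) (auto simp: pochhammer_Suc intro!: holomorphic_intros)
  ultimately show ?thesis
    unfolding psi_strip_def by (intro holomorphic_intros)
qed

text \<open>The subtracted term of index \<open>k\<close> has Mellin transform
  \<open>fps_nth ker_fps k * Gamma (s + of_nat k)\<close>. Since
  \<open>rGamma s * Gamma (s + of_nat k) = pochhammer s k\<close>, the finite sum in
  \<open>psi_strip\<close> puts back precisely what was removed, whatever \<open>N\<close>
  is.\<close>

lemma psi_strip_Re_pos:
  assumes s: "Re s > 0"
  shows "psi_strip N s = rGamma s * mellin ker s"
proof -
  let ?g = "\<lambda>k x. complex_of_real x powr (s + of_nat k - 1) * of_real (exp (- x))"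
  have g: "integrable lborel_pos (?g k)" "(\<integral>x. ?g k x \<partial>lborel_pos) = Gamma (s + of_nat k)" for k
    using Gamma_has_integral_pos[of "s + of_nat k"] s by auto
  have "mellin (ker_rem N) s =
      (\<integral>x. ker x * of_real x powr (s - 1) - (\<Sum>k<N. fps_nth ker_fps k * ?g k x) \<partial>lborel_pos)"
    unfolding mellin_def
  proof (intro Bochner_Integration.integral_cong refl)
    fix x assume "x \<in> space lborel_pos"
    hence x: "x > 0" by (simp add: space_lborel_pos)
    have "of_real x powr (s + of_nat k - 1) = of_real x powr (s - 1) * of_real x ^ k" for k
      using x powr_add[of "of_real x" "s - 1" "of_nat k"] 
      by (simp add: algebra_simps powr_nat')
    thus "ker_rem N x * of_real x powr (s - 1) =
        ker x * of_real x powr (s - 1) - (\<Sum>k<N. fps_nth ker_fps k * ?g k x)"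
      by (simp add: ker_rem_def algebra_simps sum_distrib_left)
  qed
  also have "\<dots> = mellin ker s - (\<Sum>k<N. fps_nth ker_fps k * Gamma (s + of_nat k))"
    unfolding mellin_def using integrable_ker_rem[of 0 s] s g
    by (subst Bochner_Integration.integral_diff) (auto simp: ker_rem_0)
  finally have "mellin (ker_rem N) s = mellin ker s - (\<Sum>k<N. fps_nth ker_fps k * Gamma (s + of_nat k))" .
  moreover have "s \<notin> \<int>\<^sub>\<le>\<^sub>0"
    using s by (auto elim!: nonpos_Ints_cases)
  hence "rGamma s * Gamma (s + of_nat k) = pochhammer s k" for k
    by (simp add: pochhammer_Gamma rGamma_inverse_Gamma field_simps)
  ultimately show ?thesis
    by (simp add: psi_strip_def right_diff_distrib sum_distrib_left mult.left_commute[of "rGamma s"])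
qed

text \<open>Both functions agree for \<open>Re s > 0\<close>, and the identity theorem extends this
  to the common half-plane.\<close>

lemma psi_strip_eq:
  assumes "Re s > - real M" "Re s > - real N"
  shows "psi_strip M s = psi_strip N s"
proof -
  define K where "K = min (real M) (real N)"
  have sub: "{s. Re s > - K} \<subseteq> {s. Re s > - real M}" "{s. Re s > - K} \<subseteq> {s. Re s > - real N}"
    by (auto simp: K_def)
  have "Re 1 > 0" by simp
  hence ne: "{s. Re s > 0} \<noteq> {}" by blast
  have hol: "psi_strip M holomorphic_on {s. Re s > - K}" "psi_strip N holomorphic_on {s. Re s > - K}"
    using holomorphic_psi_strip sub holomorphic_on_subset by blast+
  have conn: "connected {s. Re s > - K}"
    by (intro convex_connected convex_halfspace_Re_gt)
  have s: "s \<in> {s. Re s > - K}" "{s. Re s > 0} \<subseteq> {s. Re s > - K}"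
    using assms by (auto simp: K_def)
  have eq: "psi_strip M w = psi_strip N w" if "w \<in> {s. Re s > 0}" for w
    using that by (simp add: psi_strip_Re_pos)
  show ?thesis
    by (rule analytic_continuation_open[OF open_halfspace_Re_gt open_halfspace_Re_gt ne conn s(2) hol eq s(1)])
qed

text \<open>The index is the least natural number \<open>N\<close> with
  \<open>Re s > - real N\<close>; by \<open>psi_strip_eq\<close> any larger one gives the same
  value.\<close>

definition psi :: "complex \<Rightarrow> complex" where
  "psi s = psi_strip (nat (\<lfloor>- Re s\<rfloor> + 1)) s"

lemma psi_eq_psi_strip:
  assumes "Re s > - real N"
  shows "psi s = psi_strip N s"
proof -
  have "Re s > - real (nat (\<lfloor>- Re s\<rfloor> + 1))" by linarith
  thus ?thesis unfolding psi_def using assms by (rule psi_strip_eq)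
qed

lemma holomorphic_psi: "psi holomorphic_on UNIV"
proof -
  have "psi holomorphic_on (\<Union>N. {s. Re s > - real N})"
  proof (intro holomorphic_on_UN_open)
    fix N :: nat
    show "psi holomorphic_on {s. Re s > - real N}"
      by (rule holomorphic_transform[OF holomorphic_psi_strip]) (simp add: psi_eq_psi_strip)
  qed (auto simp: open_halfspace_Re_gt)
  also have "(\<Union>N. {s. Re s > - real N}) = UNIV"
  proof -
    have "\<exists>N. Re s > - real N" for s
      using reals_Archimedean2[of "- Re s"] by (auto simp: minus_less_iff)
    thus ?thesis by auto
  qed
  finally show ?thesis .
qed

text \<open>The recurrence \<open>(s - 1) * rGamma s = rGamma (s - 1)\<close> converts the
  normalisation of \<open>mellin_ker_sums\<close> into that of \<open>psi\<close>.\<close>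

lemma psi_sums:
  assumes "Re s > 1"
  shows "(\<lambda>n. z ^ n * of_real (real n + a) powr (- s)) sums (psi (s - 1) / (s - 1))"
proof -
  have "Re (s - 1) > 0" using assms by simp
  hence "psi (s - 1) = rGamma (s - 1) * mellin ker (s - 1)"
    using psi_eq_psi_strip[of 0 "s - 1"] by (simp add: psi_strip_Re_pos)
  moreover have "(s - 1) * rGamma s = rGamma (s - 1)"
    using rGamma_plus1[of "s - 1"] by simp
  moreover have "s \<noteq> 1" using assms by auto
  ultimately have "psi (s - 1) / (s - 1) = rGamma s * mellin ker (s - 1)"
    by (metis mult.assoc nonzero_mult_div_cancel_left right_minus_eq)
  thus ?thesis using mellin_ker_sums[OF assms] by simp
qed

text \<open>At 0, -1 and -2 the reciprocal Gamma function vanishes, which removes the integral. Only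
  the finite sum of Pochhammer terms survives, so these three values of \<open>psi\<close> are read
  off from the Taylor coefficients.\<close>

lemma psi_0: "psi 0 = fps_nth ker_fps 0"
  by (subst psi_eq_psi_strip[of 1]) (simp_all add: psi_strip_def)

lemma rGamma_neg: "rGamma (- 1 :: complex) = 0" "rGamma (- 2 :: complex) = 0"
  by (auto simp: rGamma_eq_zero_iff intro: nonpos_Ints_of_int[of "-1", simplified] nonpos_Ints_of_int[of "-2", simplified])

lemma psi_neg_1: "psi (- 1) = fps_nth ker_fps 0 - fps_nth ker_fps 1"
  by (subst psi_eq_psi_strip[of 2]) (simp_all add: psi_strip_def numeral_2_eq_2 rGamma_neg)

lemma psi_neg_2: "psi (- 2) = fps_nth ker_fps 0 - 2 * fps_nth ker_fps 1 + 2 * fps_nth ker_fps 2"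
  by (subst psi_eq_psi_strip[of 3])
     (simp_all add: psi_strip_def numeral_3_eq_3 rGamma_neg pochhammer_Suc numeral_2_eq_2)

text \<open>
  \<open>ker_fps\<close> expands \<open>exp x * ker x\<close>, so the linear Taylor coefficient of \<open>ker\<close> itself is the
  difference of the first two coefficients.
\<close>
definition ker_sub :: "real \<Rightarrow> complex" where
  "ker_sub x = ker x - fps_nth ker_fps 0 - (fps_nth ker_fps 1 - fps_nth ker_fps 0) * of_real x"

text \<open>Replacing the damped polynomial in \<open>ker_rem 2\<close> by the plain one in
  \<open>ker_sub\<close> changes the integrand by multiples of \<open>exp (- x) - 1 + x\<close> and
  \<open>x * (1 - exp (- x))\<close>. In this strip their integrals are \<open>Gamma s\<close> and
  \<open>- Gamma (s + 1)\<close>, so after multiplication by \<open>rGamma s\<close> they account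
  for the Pochhammer terms, and the integral of \<open>ker_sub\<close> alone remains.\<close>

lemma psi_real_strip:
  fixes s :: real
  assumes s: "-2 < s" "s < -1"
  shows "integrable lborel_pos (\<lambda>x. ker_sub x * of_real (x powr (s - 1)))"
    and "psi (of_real s) = of_real (rGamma s) * (\<integral>x. ker_sub x * of_real (x powr (s - 1)) \<partial>lborel_pos)"
proof -
  let ?Q = "fps_nth ker_fps"
  let ?u = "\<lambda>x::real. complex_of_real ((exp (- x) - 1 + x) * x powr (s - 1))"
  let ?v = "\<lambda>x::real. complex_of_real ((1 - exp (- x)) * x powr (s + 1 - 1))"
  have u: "integrable lborel_pos ?u" "(\<integral>x. ?u x \<partial>lborel_pos) = Gamma s"
    using Gamma_integral_subtract2[OF s] by (simp_all only: integrable_of_real integral_complex_of_real)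
  have v: "integrable lborel_pos ?v" "(\<integral>x. ?v x \<partial>lborel_pos) = - Gamma (s + 1)"
    using Gamma_integral_subtract1[of "s + 1"] s
    by (simp_all only: integrable_of_real integral_complex_of_real)
  have eq: "ker_sub x * of_real (x powr (s - 1)) =
      ker_rem 2 x * of_real x powr (of_real s - 1) + ?Q 0 * ?u x - ?Q 1 * ?v x"
    if "x \<in> space lborel_pos" for x
  proof -
    have x: "x > 0" using that by (simp add: space_lborel_pos)
    have p: "complex_of_real x powr (of_real s - 1) = of_real (x powr (s - 1))"
      using x powr_of_real[of x "s - 1"] by simp
    have p': "x powr (s + 1 - 1) = x * x powr (s - 1)"
      using x powr_add[of x "s - 1" 1] by simp
    show ?thesis
      unfolding p p' by (simp add: ker_sub_def ker_rem_def numeral_2_eq_2 algebra_simps)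
  qed
  have r: "integrable lborel_pos (\<lambda>x. ker_rem 2 x * of_real x powr (of_real s - 1))"
    using s by (intro integrable_ker_rem) auto
  have "integrable lborel_pos (\<lambda>x. ker_rem 2 x * of_real x powr (of_real s - 1) + ?Q 0 * ?u x - ?Q 1 * ?v x)"
    by (intro Bochner_Integration.integrable_diff Bochner_Integration.integrable_add r integrable_mult_right u v)
  thus "integrable lborel_pos (\<lambda>x. ker_sub x * of_real (x powr (s - 1)))"
    by (subst Bochner_Integration.integrable_cong[OF refl eq])
  have "(\<integral>x. ker_sub x * of_real (x powr (s - 1)) \<partial>lborel_pos) =
        (\<integral>x. ker_rem 2 x * of_real x powr (of_real s - 1) + ?Q 0 * ?u x - ?Q 1 * ?v x \<partial>lborel_pos)"
    by (intro Bochner_Integration.integral_cong refl eq)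
  also have "\<dots> = mellin (ker_rem 2) (of_real s) + ?Q 0 * Gamma s + ?Q 1 * Gamma (s + 1)"
    unfolding mellin_def using r u v
    by (subst Bochner_Integration.integral_diff Bochner_Integration.integral_add;
        (intro Bochner_Integration.integrable_add integrable_mult_right)?; simp)+
  finally have I: "(\<integral>x. ker_sub x * of_real (x powr (s - 1)) \<partial>lborel_pos) =
      mellin (ker_rem 2) (of_real s) + ?Q 0 * Gamma s + ?Q 1 * Gamma (s + 1)" .
  have ns: "s \<notin> \<int>\<^sub>\<le>\<^sub>0"
    using s by (intro not_nonpos_Ints_between[of "-2"]) auto
  hence "rGamma s * Gamma s = 1" "rGamma s * Gamma (s + 1) = s"
    using Gamma_plus1[of s] by (auto simp: rGamma_inverse_Gamma Gamma_eq_zero_iff)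
  hence G: "complex_of_real (rGamma s) * of_real (Gamma s) = 1"
      "complex_of_real (rGamma s) * of_real (Gamma (s + 1)) = of_real s"
    by (simp_all only: of_real_mult[symmetric] of_real_1)
  have "psi (of_real s) = rGamma (of_real s) * mellin (ker_rem 2) (of_real s) + ?Q 0 + ?Q 1 * of_real s"
    using s by (subst psi_eq_psi_strip[of 2]) (auto simp: psi_strip_def numeral_2_eq_2)
  also have "\<dots> = of_real (rGamma s) * mellin (ker_rem 2) (of_real s) +
      ?Q 0 * (of_real (rGamma s) * of_real (Gamma s)) + ?Q 1 * (of_real (rGamma s) * of_real (Gamma (s + 1)))"
    unfolding G by (simp add: rGamma_complex_of_real)
  also have "\<dots> = of_real (rGamma s) * (\<integral>x. ker_sub x * of_real (x powr (s - 1)) \<partial>lborel_pos)"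
    unfolding I by (simp add: algebra_simps)
  finally show "psi (of_real s) = of_real (rGamma s) * (\<integral>x. ker_sub x * of_real (x powr (s - 1)) \<partial>lborel_pos)" .
qed

text \<open>Everything depends on \<open>psi 0\<close>. It is 1 for \<open>z = 1\<close>, giving the
  simple pole, and 0 otherwise, making the singularity at 1 removable with value
  \<open>deriv psi 0\<close>.\<close>

lemma is_hurwitz_lerch_psi:
  "is_hurwitz_lerch a z (\<lambda>s. if s = 1 \<and> z \<noteq> 1 then deriv psi 0 else psi (s - 1) / (s - 1))"
    (is "is_hurwitz_lerch a z ?f")
proof -
  have sums: "(\<lambda>n. z ^ n * of_real (real n + a) powr (- s)) sums ?f s" if "Re s > 1" for s
    using psi_sums[OF that] that by auto
  have hol1: "(\<lambda>s. psi (s - 1)) holomorphic_on A" for A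
  proof -
    have "(psi \<circ> (\<lambda>s. s - 1)) holomorphic_on A"
      by (intro holomorphic_on_compose holomorphic_intros holomorphic_on_subset[OF holomorphic_psi]) auto
    thus ?thesis by (simp add: o_def)
  qed
  show ?thesis
  proof (cases "z = 1")
    case True
    have psi0: "psi 0 = 1" by (simp only: psi_0 ker_fps_nth_1(1)[OF True])
    have f: "?f = (\<lambda>s. psi (s - 1) / (s - 1))" using True by auto
    have "?f holomorphic_on - {1}"
      unfolding f by (intro holomorphic_intros hol1) auto
    moreover have "zorder ?f 1 = - 1"
      unfolding f by (rule zorder_eqI[of UNIV _ "\<lambda>s. psi (s - 1)"])
        (auto simp: hol1 psi0 power_int_minus divide_inverse)
    moreover have "is_pole ?f 1"
      unfolding f
    proof (rule is_pole_divide)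
      show "isCont (\<lambda>s. psi (s - 1)) 1"
        using hol1[of UNIV] by (intro continuous_on_interior[of UNIV] holomorphic_on_imp_continuous_on) auto
      show "filterlim (\<lambda>s::complex. s - 1) (at 0) (at 1)"
        by (auto simp: filterlim_at eventually_at_filter intro!: tendsto_eq_intros)
    qed (simp add: psi0)
    ultimately show ?thesis using sums True by (simp add: is_hurwitz_lerch_def)
  next
    case False
    have psi0: "psi 0 = 0" by (simp only: psi_0 ker_fps_nth_neq_1(1)[OF False])
    have "(\<lambda>w. if w = 0 then deriv psi 0 else (psi w - psi 0) / (w - 0)) holomorphic_on UNIV"
      by (rule pole_lemma_open[OF holomorphic_psi open_UNIV])
    hence "(\<lambda>w. if w = 0 then deriv psi 0 else (psi w - psi 0) / (w - 0)) \<circ> (\<lambda>s. s - 1) holomorphic_on UNIV"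
      by (intro holomorphic_on_compose) (auto intro!: holomorphic_intros intro: holomorphic_on_subset)
    also have "(\<lambda>w. if w = 0 then deriv psi 0 else (psi w - psi 0) / (w - 0)) \<circ> (\<lambda>s. s - 1) = ?f"
      using False by (auto simp: fun_eq_iff psi0)
    finally show ?thesis using sums False by (simp add: is_hurwitz_lerch_def)
  qed
qed

text \<open>Existence shows that the function chosen by \<open>SOME\<close> is a continuation;
  uniqueness identifies it away from 1.\<close>

lemma hurwitz_lerch_eq_psi:
  assumes "s \<noteq> 1"
  shows "hurwitz_lerch s a z = psi (s - 1) / (s - 1)"
proof -
  have "is_hurwitz_lerch a z (SOME f. is_hurwitz_lerch a z f)"
    using is_hurwitz_lerch_psi by (rule someI[where P = "is_hurwitz_lerch a z"])
  from is_hurwitz_lerch_unique[OF this is_hurwitz_lerch_psi, of s] show ?thesis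
    using assms by (simp add: hurwitz_lerch_def)
qed

end

section \<open>Inequalities for the hyperbolic functions\<close>

lemma sinh_sums_odd: "(\<lambda>k. x ^ (2 * k + 1) / fact (2 * k + 1)) sums sinh x" for x :: real
proof -
  have "(\<lambda>k. if even (2 * k + 1) then 0 else x ^ (2 * k + 1) /\<^sub>R fact (2 * k + 1)) sums sinh x"
    using sinh_converges[of x]
    by (subst sums_mono_reindex[of "\<lambda>k. 2 * k + 1" "\<lambda>n. if even n then 0 else x ^ n /\<^sub>R fact n"])
       (auto simp: strict_mono_def elim!: oddE)
  thus ?thesis by (simp add: divide_inverse mult.commute)
qed

lemma cosh_sums_even: "(\<lambda>k. x ^ (2 * k) / fact (2 * k)) sums cosh x" for x :: real
proof -
  have "(\<lambda>k. if even (2 * k) then x ^ (2 * k) /\<^sub>R fact (2 * k) else 0) sums cosh x"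
    using cosh_converges[of x]
    by (subst sums_mono_reindex[of "\<lambda>k. 2 * k" "\<lambda>n. if even n then x ^ n /\<^sub>R fact n else 0"])
       (auto simp: strict_mono_def elim!: evenE)
  thus ?thesis by (simp add: divide_inverse mult.commute)
qed

text \<open>Termwise comparison of the power series: an odd power of \<open>d\<close> is at most
  \<open>d\<close>.\<close>

lemma sinh_mult_le:
  fixes d y :: real
  assumes "0 \<le> d" "d \<le> 1" "0 \<le> y"
  shows "sinh (d * y) \<le> d * sinh y"
proof (rule sums_le[OF _ sinh_sums_odd sums_mult[OF sinh_sums_odd]])
  fix k
  have "d * d ^ (2 * k) \<le> d * 1"
    using assms by (intro mult_left_mono power_le_one) auto
  hence "d ^ (2 * k + 1) * (y ^ (2 * k + 1) / fact (2 * k + 1)) \<le> d * (y ^ (2 * k + 1) / fact (2 * k + 1))"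
    using assms by (intro mult_right_mono) auto
  thus "(d * y) ^ (2 * k + 1) / fact (2 * k + 1) \<le> d * (y ^ (2 * k + 1) / fact (2 * k + 1))"
    by (simp only: power_mult_distrib times_divide_eq_right)
qed

text \<open>Termwise, this is \<open>(2 k + 1) d ^ (2 k) \<le> 1\<close>, which \<open>2 k + 1 \<le> 3 ^ k\<close> provides.\<close>
lemma mult_cosh_less_sinh:
  fixes d y :: real
  assumes "3 * d\<^sup>2 \<le> 1" "0 < y"
  shows "y * cosh (d * y) < sinh y"
proof -
  have pow: "real (2 * k + 1) * d ^ (2 * k) \<le> 1" for k
  proof -
    have "real (2 * k + 1) \<le> 3 ^ k" by (induction k) auto
    hence "real (2 * k + 1) * d ^ (2 * k) \<le> 3 ^ k * (d\<^sup>2) ^ k"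
      unfolding power_mult by (intro mult_right_mono) auto
    also have "\<dots> = (3 * d\<^sup>2) ^ k" by (simp add: power_mult_distrib)
    also have "\<dots> \<le> 1" using assms by (intro power_le_one) auto
    finally show ?thesis .
  qed
  let ?f = "\<lambda>k. y ^ (2 * k + 1) / fact (2 * k + 1) - y * ((d * y) ^ (2 * k) / fact (2 * k))"
  have f: "?f k = y ^ (2 * k + 1) / fact (2 * k + 1) * (1 - real (2 * k + 1) * d ^ (2 * k))" for k
  proof -
    have "fact (2 * k + 1) = real (2 * k + 1) * (fact (2 * k))" by simp
    hence "1 / fact (2 * k) = real (2 * k + 1) / fact (2 * k + 1)" 
      by (simp del: fact_Suc)
    hence "y * ((d * y) ^ (2 * k) / fact (2 * k)) = y * (d * y) ^ (2 * k) * (real (2 * k + 1) / fact (2 * k + 1))"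
      by (metis times_divide_eq_right mult.assoc mult_1_right)
    also have "\<dots> = y ^ (2 * k + 1) / fact (2 * k + 1) * (real (2 * k + 1) * d ^ (2 * k))"
      by (simp add: power_mult_distrib)
    finally show ?thesis by (simp only: right_diff_distrib mult_1_right)
  qed
  have sums: "?f sums (sinh y - y * cosh (d * y))"
    by (intro sums_diff sums_mult sinh_sums_odd cosh_sums_even)
  \<comment> \<open>Strictness comes from the term with \<open>k = 2\<close>: the term with
    \<open>k = 0\<close> is 0, and the one with \<open>k = 1\<close> vanishes when
    \<open>3 * d\<^sup>2 = 1\<close>, whereas \<open>5 * d ^ 4 \<le> 5 / 9\<close>.\<close>
  have "0 < suminf ?f"
  proof (rule suminf_pos2[of _ 2])
    show "summable ?f" using sums by (rule sums_summable)
    show "0 \<le> ?f k" for k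
      unfolding f using assms pow[of k] by (intro mult_nonneg_nonneg) auto
    have "(3 * d\<^sup>2)\<^sup>2 \<le> 1\<^sup>2" using assms by (intro power_mono) auto
    hence "5 * d ^ 4 < 1" by (simp add: power_mult_distrib)
    thus "0 < ?f 2"
      unfolding f using assms by (intro mult_pos_pos) auto
  qed
  thus ?thesis using sums by (simp add: sums_iff)
qed

text \<open>Termwise again, from \<open>6 ^ k * fact k \<le> fact (2 * k + 1)\<close>. The constant
  6 makes the cubic terms of both sides agree.\<close>

lemma sinh_le_mult_exp:
  fixes y :: real
  assumes "0 \<le> y"
  shows "sinh y \<le> y * exp (y\<^sup>2 / 6)"
proof (rule sums_le[OF _ sinh_sums_odd sums_mult[OF exp_converges]])
  fix k
  have "(6 ^ k * fact k :: real) \<le> fact (2 * k + 1)"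
  proof (induction k)
    case (Suc k)
    have "(6 ^ Suc k * fact (Suc k) :: real) = (6 * (real k + 1)) * (6 ^ k * fact k)"
      by (simp add: algebra_simps)
    also have "\<dots> \<le> ((2 * real k + 3) * (2 * real k + 2)) * fact (2 * k + 1)"
    proof (rule mult_mono[OF _ Suc])
      have "0 \<le> 4 * (real k)\<^sup>2 + 4 * real k" by simp
      thus "6 * (real k + 1) \<le> (2 * real k + 3) * (2 * real k + 2)"
        by (simp add: algebra_simps power2_eq_square)
    qed auto
    also have "\<dots> = fact (2 * Suc k + 1)"
      by (simp add: algebra_simps)
    finally show ?case .
  qed simp
  hence "y ^ (2 * k + 1) / fact (2 * k + 1) \<le> y ^ (2 * k + 1) / (6 ^ k * fact k)"
    using assms by (intro divide_left_mono mult_pos_pos) auto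
  also have "\<dots> = y * ((y\<^sup>2 / 6) ^ k /\<^sub>R fact k)"
  proof -
    have "y ^ (2 * k + 1) = y * (y\<^sup>2) ^ k" by (simp add: power_mult)
    moreover have "y * p / (r * f) = y * ((p / r) /\<^sub>R f)" for p r f :: real
      by (simp add: divide_inverse)
    ultimately show ?thesis by (simp only: power_divide)
  qed
  finally show "y ^ (2 * k + 1) / fact (2 * k + 1) \<le> y * ((y\<^sup>2 / 6) ^ k /\<^sub>R fact k)" .
qed

text \<open>After multiplication by \<open>exp t\<close> the left side is a function with value 1 at
  0 and derivative \<open>- t\<^sup>2 * exp (t + t\<^sup>2 / 2)\<close>.\<close>

lemma one_minus_mult_exp_less:
  fixes t :: real
  assumes "0 < t"
  shows "(1 - t) * exp (t\<^sup>2 / 2) < exp (- t)"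
proof -
  have "(1 - t) * exp (t + t\<^sup>2 / 2) < (1 - 0) * exp (0 + 0\<^sup>2 / 2)"
  proof (rule DERIV_neg_imp_decreasing_open[OF assms])
    fix x :: real assume x: "0 < x" "x < t"
    have "((\<lambda>t. (1 - t) * exp (t + t\<^sup>2 / 2)) has_real_derivative - x\<^sup>2 * exp (x + x\<^sup>2 / 2)) (at x)"
      by (auto intro!: derivative_eq_intros simp: algebra_simps power2_eq_square)
    moreover have "- x\<^sup>2 * exp (x + x\<^sup>2 / 2) < 0" using x by simp
    ultimately show "\<exists>y. ((\<lambda>t. (1 - t) * exp (t + t\<^sup>2 / 2)) has_real_derivative y) (at x) \<and> y < 0"
      by blast
  qed (auto intro!: continuous_intros)
  hence "((1 - t) * exp (t\<^sup>2 / 2)) * exp t < exp (- t) * exp t"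
    by (simp add: exp_add[symmetric] mult.assoc add.commute)
  thus ?thesis by simp
qed

text \<open>With \<open>y = x / 2\<close> and \<open>d = 2 * c\<close> the exponential is
  \<open>cosh (d * y) + sinh (d * y)\<close>, and the two summands are estimated separately. The
  hypothesis on \<open>c\<close> is \<open>3 * d\<^sup>2 \<le> 1\<close>.\<close>

lemma mult_exp_less_sinh:
  fixes c x :: real
  assumes "0 \<le> c" "12 * c\<^sup>2 \<le> 1" "0 < x"
  shows "x * exp (c * x) < 2 * sinh (x / 2) * (1 + c * x)"
proof -
  define y d where "y = x / 2" and "d = 2 * c"
  have d: "3 * d\<^sup>2 \<le> 1" "0 \<le> d" using assms by (auto simp: d_def)
  have "d \<le> 1"
    by (rule power2_le_imp_le) (use d zero_le_power2[of d] in auto)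
  have y: "y > 0" using assms by (simp add: y_def)
  have "x * exp (c * x) = 2 * y * (cosh (d * y) + sinh (d * y))"
    unfolding cosh_plus_sinh by (simp add: y_def d_def)
  also have "\<dots> = 2 * (y * cosh (d * y)) + 2 * y * sinh (d * y)"
    by (simp only: distrib_left mult.assoc)
  also have "\<dots> < 2 * sinh y + 2 * y * (d * sinh y)"
    using d \<open>d \<le> 1\<close> y
    by (intro add_less_le_mono mult_strict_left_mono mult_left_mono mult_cosh_less_sinh sinh_mult_le) auto
  also have "\<dots> = 2 * sinh (x / 2) * (1 + c * x)"
    by (simp add: y_def d_def distrib_left)
  finally show ?thesis .
qed

text \<open>For \<open>c * x < 1\<close>, \<open>sinh_le_mult_exp\<close> yields the exponent
  \<open>x\<^sup>2 / 24\<close>, and \<open>12 * c\<^sup>2 \<ge> 1\<close> says that this is at most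
  \<open>(c * x)\<^sup>2 / 2\<close>, as \<open>one_minus_mult_exp_less\<close> requires. Otherwise
  the left side is not positive.\<close>

lemma sinh_less_mult_exp_neg:
  fixes c x :: real
  assumes "0 \<le> c" "12 * c\<^sup>2 \<ge> 1" "0 < x"
  shows "2 * sinh (x / 2) * (1 - c * x) < x * exp (- c * x)"
proof (cases "c * x < 1")
  case True
  have "c \<noteq> 0" using assms by auto
  hence t: "0 < c * x" using assms by simp
  have "x\<^sup>2 / 24 \<le> (c * x)\<^sup>2 / 2"
    using mult_right_mono[OF assms(2), of "x\<^sup>2"] by (simp add: power_mult_distrib)
  have "sinh (x / 2) \<le> x / 2 * exp ((x / 2)\<^sup>2 / 6)"
    using assms by (intro sinh_le_mult_exp) auto
  also have "\<dots> \<le> x / 2 * exp ((c * x)\<^sup>2 / 2)"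
    using \<open>x\<^sup>2 / 24 \<le> _\<close> assms by (intro mult_left_mono) (auto simp: power_divide)
  finally have "2 * sinh (x / 2) * (1 - c * x) \<le> x * exp ((c * x)\<^sup>2 / 2) * (1 - c * x)"
    using True by (intro mult_right_mono) auto
  also have "\<dots> = x * ((1 - c * x) * exp ((c * x)\<^sup>2 / 2))" by simp
  also have "\<dots> < x * exp (- (c * x))"
    using assms t by (intro mult_strict_left_mono one_minus_mult_exp_less) auto
  finally show ?thesis by simp
next
  case False
  hence "2 * sinh (x / 2) * (1 - c * x) \<le> 0"
    using assms by (intro mult_nonneg_nonpos) auto
  also have "0 < x * exp (- c * x)" using assms by simp
  finally show ?thesis .
qed

text \<open>The difference \<open>?G\<close> of the two sides vanishes at 0 and increases: up to the
  factor \<open>exp (- u)\<close> its derivative is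
  \<open>t + a * (1 - t) * exp ((1 - a) * u)\<close>. Putting 1 for the last exponential leaves
  \<open>1 - (1 - t) * (1 - a)\<close>, which is nonnegative.\<close>

lemma exp_convex_combination_less:
  fixes a t x :: real
  assumes "0 < a" "a \<le> 1" "t < 1" "(1 - t) * (1 - a) \<le> 1" "0 < x"
  shows "(1 - t) * exp (- a * x) < 1 - t * exp (- x)"
proof -
  let ?G = "\<lambda>x. 1 - t * exp (- x) - (1 - t) * exp (- a * x)"
  have "?G 0 < ?G x"
  proof (rule DERIV_pos_imp_increasing_open[OF assms(5)])
    fix u :: real assume u: "0 < u" "u < x"
    have e: "exp (- a * u) = exp (- u) * exp ((1 - a) * u)"
      by (simp add: exp_add[symmetric] algebra_simps)
    have "(?G has_real_derivative exp (- u) * (t + a * (1 - t) * exp ((1 - a) * u))) (at u)"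
      unfolding distrib_left mult.left_commute[of "exp (- u)"] e[symmetric]
      by (auto intro!: derivative_eq_intros)
    moreover have "t + a * (1 - t) * exp ((1 - a) * u) > 0"
    \<comment> \<open>For \<open>a < 1\<close> strictness comes from the exponential exceeding 1.
      For \<open>a = 1\<close> the exponential is constant, but the expression equals 1.\<close>
    proof (cases "a = 1")
      case False
      hence "1 < exp ((1 - a) * u)" using assms u by simp
      hence "a * (1 - t) * 1 < a * (1 - t) * exp ((1 - a) * u)"
        using assms by (intro mult_strict_left_mono) auto
      thus ?thesis using assms(4) by (simp add: algebra_simps)
    qed (use assms in auto)
    ultimately have "exp (- u) * (t + a * (1 - t) * exp ((1 - a) * u)) > 0"
      and "(?G has_real_derivative exp (- u) * (t + a * (1 - t) * exp ((1 - a) * u))) (at u)"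
      by simp_all
    thus "\<exists>y. (?G has_real_derivative y) (at u) \<and> y > 0" by blast
  qed (auto intro!: continuous_intros)
  thus ?thesis by simp
qed

section \<open>Zeros in the strip\<close>

lemma integral_lborel_pos_pos:
  fixes f :: "real \<Rightarrow> real"
  assumes "integrable lborel_pos f" "\<And>x. x > 0 \<Longrightarrow> f x > 0"
  shows "(\<integral>x. f x \<partial>lborel_pos) > 0"
proof -
  have nonneg: "AE x in lborel_pos. 0 \<le> f x"
    using assms(2) by (intro AE_I2) (auto simp: space_lborel_pos intro: less_imp_le)
  have "(\<integral>x. f x \<partial>lborel_pos) \<noteq> 0"
  proof
    assume "(\<integral>x. f x \<partial>lborel_pos) = 0"
    hence "AE x in lborel_pos. f x = 0"
      using integral_nonneg_eq_0_iff_AE[OF assms(1) nonneg] by simp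
    moreover have "AE x in lborel_pos. f x \<noteq> 0"
      using assms(2) by (intro AE_I2) (force simp: space_lborel_pos)
    ultimately have "AE x in lborel_pos. False" by eventually_elim simp
    hence "emeasure lborel {0::real<..} = 0"
      by (simp add: eventually_False ae_filter_eq_bot_iff space_lborel_pos emeasure_restrict_space)
    moreover have "emeasure lborel {0<..1::real} \<le> emeasure lborel {0::real<..}"
      by (intro emeasure_mono) auto
    ultimately show False by simp
  qed
  moreover have "(\<integral>x. f x \<partial>lborel_pos) \<ge> 0"
    using nonneg by (rule integral_nonneg_AE)
  ultimately show ?thesis by simp
qed

section \<open>Sign criteria for \<open>psi\<close> between -2 and -1\<close>

context hurwitz_lerch_params
begin

text \<open>A real functional that is positive on the integrand is positive on the integral. Leaving
  \<open>L\<close> open covers the real part with either sign as well as the imaginary part.\<close>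

lemma psi_nonzero:
  fixes s :: real and L :: "complex \<Rightarrow> real"
  assumes s: "-2 < s" "s < -1"
    and L: "bounded_linear L" "\<And>x. x > 0 \<Longrightarrow> L (ker_sub x) > 0"
  shows "psi (of_real s) \<noteq> 0"
proof -
  let ?f = "\<lambda>x. ker_sub x * of_real (x powr (s - 1))"
  have Lf: "L (?f x) = x powr (s - 1) * L (ker_sub x)" for x
    using linear_scale[OF bounded_linear.linear[OF L(1)], of "x powr (s - 1)" "ker_sub x"]
    by (simp add: scaleR_conv_of_real mult.commute)
  have "(\<integral>x. L (?f x) \<partial>lborel_pos) > 0"
    using integrable_bounded_linear[OF L(1) psi_real_strip(1)[OF s]] L(2)
    by (intro integral_lborel_pos_pos) (auto simp: Lf)
  also have "(\<integral>x. L (?f x) \<partial>lborel_pos) = L (\<integral>x. ?f x \<partial>lborel_pos)"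
    by (rule integral_bounded_linear[OF L(1) psi_real_strip(1)[OF s]])
  finally have "(\<integral>x. ?f x \<partial>lborel_pos) \<noteq> 0"
    using linear_0[OF bounded_linear.linear[OF L(1)]] by auto
  moreover have "s \<notin> \<int>\<^sub>\<le>\<^sub>0"
    using s by (intro not_nonpos_Ints_between[of "-2"]) auto
  hence "rGamma s \<noteq> 0" by (simp add: rGamma_eq_zero_iff)
  ultimately show ?thesis
    by (simp add: psi_real_strip(2)[OF s])
qed

lemma Im_psi_eq_0:
  fixes s :: real
  assumes s: "-2 < s" "s < -1" and "\<And>x. x > 0 \<Longrightarrow> Im (ker_sub x) = 0"
  shows "Im (psi (of_real s)) = 0"
proof -
  let ?f = "\<lambda>x. ker_sub x * of_real (x powr (s - 1))"
  have "Im (\<integral>x. ?f x \<partial>lborel_pos) = (\<integral>x. Im (?f x) \<partial>lborel_pos)"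
    by (rule integral_bounded_linear[OF bounded_linear_Im psi_real_strip(1)[OF s], symmetric])
  also have "\<dots> = (\<integral>x. 0 \<partial>lborel_pos)"
    using assms(3) by (intro Bochner_Integration.integral_cong refl) (simp add: space_lborel_pos)
  finally show ?thesis by (simp add: psi_real_strip(2)[OF s])
qed

text \<open>A real \<open>ker_sub\<close> makes \<open>psi\<close> real on the interval, so a zero
  of the real part is a zero of \<open>psi\<close>. The hypothesis on the product is the sign change
  for the intermediate value theorem and also excludes the end points. As \<open>psi (- 1)\<close>
  and \<open>psi (- 2)\<close> are -1 and -2 times the values of the zeta function at 0 and -1, it
  says that those values have opposite signs.\<close>

lemma psi_zero_exists:
  assumes real: "\<And>x. x > 0 \<Longrightarrow> Im (ker_sub x) = 0"
    and "Re (psi (- 1)) * Re (psi (- 2)) < 0"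
  shows "\<exists>s. -2 < s \<and> s < -1 \<and> psi (of_real s) = 0"
proof -
  let ?g = "\<lambda>s::real. Re (psi (of_real s))"
  have g: "?g (- 1) * ?g (- 2) < 0" using assms(2) by simp
  have cont: "continuous_on {-2..-1} ?g"
    by (intro continuous_on_Re continuous_on_compose2[OF holomorphic_on_imp_continuous_on[OF holomorphic_psi]]
          continuous_on_of_real continuous_on_id) auto
  have "\<exists>s. -2 \<le> s \<and> s \<le> -1 \<and> ?g s = 0"
  proof (cases "?g (- 1) > 0")
    case True
    hence "?g (- 2) \<le> 0" using g by (simp add: mult_less_0_iff)
    thus ?thesis using True cont IVT'[of ?g "-2" 0 "-1"] by auto
  next
    case False
    hence "?g (- 2) \<ge> 0" "?g (- 1) \<le> 0" using g by (auto simp: mult_less_0_iff)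
    thus ?thesis using cont IVT2'[of ?g "-1" 0 "-2"] by auto
  qed
  then obtain s where s: "-2 \<le> s" "s \<le> -1" "?g s = 0" by blast
  have "s \<noteq> -2" "s \<noteq> -1" using g s(3) by (auto simp: mult_less_0_iff)
  hence s': "-2 < s" "s < -1" using s by auto
  moreover have "psi (of_real s) = 0"
    using s(3) Im_psi_eq_0[OF s' real] by (simp add: complex_eq_iff)
  ultimately show ?thesis by blast
qed

lemma hurwitz_lerch_nonzero_iff:
  "(\<forall>\<sigma>::real. -1 < \<sigma> \<and> \<sigma> < 0 \<longrightarrow> hurwitz_lerch (of_real \<sigma>) a z \<noteq> 0) \<longleftrightarrow>
   (\<forall>s::real. -2 < s \<and> s < -1 \<longrightarrow> psi (of_real s) \<noteq> 0)"
proof (intro iffI allI impI)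
  fix s :: real
  assume *: "\<forall>\<sigma>::real. -1 < \<sigma> \<and> \<sigma> < 0 \<longrightarrow> hurwitz_lerch (of_real \<sigma>) a z \<noteq> 0" and s: "-2 < s \<and> s < -1"
  have "complex_of_real (s + 1) \<noteq> 1" using s by (simp del: of_real_add)
  from hurwitz_lerch_eq_psi[OF this] show "psi (of_real s) \<noteq> 0"
    using *[rule_format, of "s + 1"] s by auto
next
  fix \<sigma> :: real
  assume *: "\<forall>s::real. -2 < s \<and> s < -1 \<longrightarrow> psi (of_real s) \<noteq> 0" and \<sigma>: "-1 < \<sigma> \<and> \<sigma> < 0"
  have ne: "complex_of_real \<sigma> \<noteq> 1" using \<sigma> by simp
  from hurwitz_lerch_eq_psi[OF this] show "hurwitz_lerch (of_real \<sigma>) a z \<noteq> 0"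
    using *[rule_format, of "\<sigma> - 1"] \<sigma> ne by auto
qed

text \<open>The imaginary part of \<open>ker_sub x\<close> compares
  \<open>Im (1 / (1 - z * r))\<close> at \<open>r = exp (- x)\<close>, damped by
  \<open>exp (- a * x)\<close>, with its value at \<open>r = 1\<close>. The factor
  \<open>- Im z\<close> in the functional treats both half-planes at once.\<close>

lemma psi_nonzero_nonreal:
  fixes s :: real
  assumes s: "-2 < s" "s < -1" and z: "z \<notin> \<real>"
  shows "psi (of_real s) \<noteq> 0"
proof (rule psi_nonzero[OF s, where L = "\<lambda>w. - Im z * Im w"])
  show "bounded_linear (\<lambda>w. - Im z * Im w)"
    by (intro bounded_linear_const_mult bounded_linear_Im)
next
  fix x :: real assume x: "x > 0"
  define q where "q = exp (- x)"
  have q: "0 < q" "q < 1" using x by (auto simp: q_def)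
  define E where "E = exp (- a * x)"
  have E: "0 < E" "E \<le> 1" using x a_pos by (auto simp: E_def)
  have z1: "z \<noteq> 1" and y: "Im z \<noteq> 0" using z by (auto simp: complex_is_Real_iff)
  have inv: "Im (1 / (1 - z * of_real r)) = Im z * r / (norm (1 - z * of_real r))\<^sup>2" for r
    by (simp add: Im_divide cmod_power2)
  have ker: "ker x = of_real (x * E) * (1 / (1 - z * of_real q))"
    by (simp add: ker_def q_def E_def)
  \<comment> \<open>Writing \<open>1 - z * of_real 1\<close> lets \<open>inv\<close> apply to both
    fractions.\<close>
  have sub: "ker_sub x = of_real x * (of_real E * (1 / (1 - z * of_real q)) - 1 / (1 - z * of_real 1))"
    using ker_fps_nth_neq_1[OF z1] unfolding ker_sub_def ker by (simp add: algebra_simps)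
  have "Im (ker_sub x) = x * (E * Im (1 / (1 - z * of_real q)) - Im (1 / (1 - z * of_real 1)))"
  proof -
    have "Im (of_real r * w) = r * Im w" for r w by simp
    thus ?thesis unfolding sub by (simp only: minus_complex.sel)
  qed
  also have "\<dots> = - x * Im z * (1 / (norm (1 - z))\<^sup>2 - E * q / (norm (1 - z * of_real q))\<^sup>2)"
    unfolding inv by (simp add: algebra_simps)
  finally have Im: "- Im z * Im (ker_sub x) =
      x * (Im z)\<^sup>2 * (1 / (norm (1 - z))\<^sup>2 - E * q / (norm (1 - z * of_real q))\<^sup>2)"
    by (simp add: power2_eq_square)
  have n: "(norm (1 - z * of_real r))\<^sup>2 = 1 - 2 * r * Re z + r\<^sup>2 * (norm z)\<^sup>2" for r
    unfolding cmod_power2 by (simp add: power2_eq_square algebra_simps)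
  have "E * (q * (norm (1 - z))\<^sup>2) \<le> 1 * (q * (norm (1 - z))\<^sup>2)"
    using E q by (intro mult_right_mono) auto
  also have "\<dots> < (norm (1 - z * of_real q))\<^sup>2"
  proof -
    have "(norm z)\<^sup>2 * q < 1"
      using q z_le_1 by (smt (verit) mult_left_le_one_le norm_ge_zero power_le_one zero_le_power)
    hence "0 < (1 - q) * (1 - (norm z)\<^sup>2 * q)" using q by simp
    thus ?thesis unfolding n[of q] n[of 1, simplified] by (simp add: algebra_simps power2_eq_square)
  qed
  finally have "E * q / (norm (1 - z * of_real q))\<^sup>2 < 1 / (norm (1 - z))\<^sup>2"
    using z1 denominator_nonzero[OF x] unfolding q_def[symmetric]
    by (simp add: divide_simps mult_ac)
  thus "- Im z * Im (ker_sub x) > 0"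
    unfolding Im using x y by simp
qed

lemma ker_sub_real:
  assumes z: "z = of_real t" "t < 1" and x: "x > 0"
  shows "ker_sub x = of_real (x * (exp (- a * x) / (1 - t * exp (- x)) - 1 / (1 - t)))"
proof -
  have z1: "z \<noteq> 1" using z by simp
  have "ker x = of_real (x * (exp (- a * x) / (1 - t * exp (- x))))"
    unfolding ker_def unfolding z(1) by simp
  thus ?thesis
    unfolding ker_sub_def ker_fps_nth_neq_1[OF z1] by (simp add: z(1) algebra_simps)
qed

text \<open>Under the inequality \<open>ker_sub\<close> is negative by
  \<open>exp_convex_combination_less\<close>. If it fails, \<open>psi (- 1) = - 1 / (1 - t)\<close>
  is negative, while \<open>psi (- 2)\<close> has the sign of \<open>(1 - t) * (1 - a) - 1\<close>,
  hence is positive.\<close>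

lemma psi_nonzero_iff_real:
  assumes z: "z = of_real t" "t < 1"
  shows "(\<forall>s::real. -2 < s \<and> s < -1 \<longrightarrow> psi (of_real s) \<noteq> 0) \<longleftrightarrow> (1 - t) * (1 - a) \<le> 1"
proof
  assume le: "(1 - t) * (1 - a) \<le> 1"
  show "\<forall>s::real. -2 < s \<and> s < -1 \<longrightarrow> psi (of_real s) \<noteq> 0"
  proof (intro allI impI)
    fix s :: real assume s: "-2 < s \<and> s < -1"
    show "psi (of_real s) \<noteq> 0"
    proof (rule psi_nonzero[where L = "\<lambda>w. - Re w"])
      fix x :: real assume x: "x > 0"
      have *: "(1 - t) * exp (- a * x) < 1 - t * exp (- x)"
        using a_pos a_le_1 z(2) le x by (rule exp_convex_combination_less)
      moreover have "0 < (1 - t) * exp (- a * x)" using z(2) by simp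
      ultimately have "0 < 1 - t * exp (- x)" by linarith
      hence "exp (- a * x) / (1 - t * exp (- x)) < 1 / (1 - t)"
        using z(2) * by (simp add: divide_simps mult_ac)
      hence "x * (exp (- a * x) / (1 - t * exp (- x)) - 1 / (1 - t)) < 0"
        using x by (intro mult_pos_neg) auto
      thus "- Re (ker_sub x) > 0"
        by (simp only: ker_sub_real[OF z x] Re_complex_of_real)
    qed (use s in \<open>auto intro!: bounded_linear_minus bounded_linear_Re\<close>)
  qed
next
  assume *: "\<forall>s::real. -2 < s \<and> s < -1 \<longrightarrow> psi (of_real s) \<noteq> 0"
  have z1: "z \<noteq> 1" using z by simp
  show "(1 - t) * (1 - a) \<le> 1"
  proof (rule ccontr)
    assume gt: "\<not> (1 - t) * (1 - a) \<le> 1"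
    have "psi (- 1) = of_real (- 1 / (1 - t))"
      unfolding psi_neg_1 ker_fps_nth_neq_1[OF z1] unfolding z(1) by simp
    hence 1: "Re (psi (- 1)) = - 1 / (1 - t)" by (simp only: Re_complex_of_real)
    have "psi (- 2) = of_real (- 2 / (1 - t) + 2 * ((1 - a) / (1 - t) - t / (1 - t)\<^sup>2))"
      unfolding psi_neg_2 ker_fps_nth_neq_1[OF z1] unfolding z(1) by simp
    hence "Re (psi (- 2)) = - 2 / (1 - t) + 2 * ((1 - a) / (1 - t) - t / (1 - t)\<^sup>2)"
      by (simp only: Re_complex_of_real)
    also have "\<dots> = 2 * ((1 - t) * (1 - a) - 1) / (1 - t)\<^sup>2"
      using z(2) by (simp add: divide_simps) (simp add: algebra_simps power2_eq_square)
    also have "\<dots> > 0" using gt z(2) by simp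
    finally have 2: "Re (psi (- 2)) > 0" .
    have "Re (psi (- 1)) < 0" unfolding 1 using z(2) by simp
    hence "Re (psi (- 1)) * Re (psi (- 2)) < 0" using 2 by (rule mult_neg_pos)
    moreover have "Im (ker_sub x) = 0" if "x > 0" for x
      by (simp only: ker_sub_real[OF z that] Im_complex_of_real)
    ultimately show False using psi_zero_exists * by blast
  qed
qed

text \<open>Extracting \<open>exp (- (x / 2))\<close> from numerator and denominator makes the
  kernel symmetric about \<open>a = 1 / 2\<close>; the sign of the new numerator is the subject of
  the two hyperbolic inequalities, with \<open>c\<close> the distance of \<open>a\<close> from
  \<open>1 / 2\<close>.\<close>

lemma ker_sub_1:
  assumes z: "z = 1" and x: "x > 0"
  shows "ker_sub x = of_real ((x * exp ((1 / 2 - a) * x) - 2 * sinh (x / 2) * (1 + (1 / 2 - a) * x)) / (2 * sinh (x / 2)))"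
proof -
  have e: "exp (- x) = exp (- (x / 2)) * exp (- (x / 2))" "exp (- a * x) = exp (- (x / 2)) * exp ((1 / 2 - a) * x)"
    "exp (- (x / 2)) * exp (x / 2) = 1"
    by (simp_all add: exp_add[symmetric] algebra_simps)
  have s: "2 * sinh (x / 2) = exp (x / 2) - exp (- (x / 2))"
    by (simp add: sinh_field_def)
  have "sinh (x / 2) > 0" using x by simp
  have "1 - exp (- x) = exp (- (x / 2)) * (2 * sinh (x / 2))"
    unfolding s right_diff_distrib e(1,3) by simp
  hence *: "x * exp (- a * x) / (1 - exp (- x)) = x * exp ((1 / 2 - a) * x) / (2 * sinh (x / 2))"
    unfolding e(2) by simp
  have "ker x = of_real (x * exp (- a * x) / (1 - exp (- x)))"
    unfolding ker_def unfolding z by simp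
  hence "ker_sub x = of_real (x * exp (- a * x) / (1 - exp (- x)) - (1 + (1 / 2 - a) * x))"
    unfolding ker_sub_def ker_fps_nth_1[OF z] by (simp only: of_real_diff) (simp add: algebra_simps)
  also note *
  also have "x * exp ((1 / 2 - a) * x) / (2 * sinh (x / 2)) - (1 + (1 / 2 - a) * x) =
      (x * exp ((1 / 2 - a) * x) - 2 * sinh (x / 2) * (1 + (1 / 2 - a) * x)) / (2 * sinh (x / 2))"
    using \<open>sinh (x / 2) > 0\<close> by (simp add: diff_divide_distrib)
  finally show ?thesis .
qed

text \<open>Here \<open>psi (- 1)\<close> and \<open>psi (- 2)\<close> are the Bernoulli polynomials
  \<open>a - 1 / 2\<close> and \<open>a\<^sup>2 - a + 1 / 6\<close>, the latter with roots
  \<open>b2_minus\<close> and \<open>b2_plus\<close>. On the stated ranges \<open>ker_sub\<close>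
  has constant sign; on the complementary ones the two values have opposite signs.\<close>

lemma psi_nonzero_iff_1:
  assumes z: "z = 1"
  shows "(\<forall>s::real. -2 < s \<and> s < -1 \<longrightarrow> psi (of_real s) \<noteq> 0) \<longleftrightarrow>
    b2_minus \<le> a \<and> a \<le> 1 / 2 \<or> b2_plus \<le> a"
proof
  assume *: "b2_minus \<le> a \<and> a \<le> 1 / 2 \<or> b2_plus \<le> a"
  show "\<forall>s::real. -2 < s \<and> s < -1 \<longrightarrow> psi (of_real s) \<noteq> 0"
  proof (intro allI impI)
    fix s :: real assume s: "-2 < s \<and> s < -1"
    from * show "psi (of_real s) \<noteq> 0"
    proof
      assume a: "b2_minus \<le> a \<and> a \<le> 1 / 2"
      \<comment> \<open>Both roots lie at distance \<open>sqrt 3 / 6\<close> from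
        \<open>1 / 2\<close>, and the square of this is \<open>1 / 12\<close>, the threshold in the
        hyperbolic inequalities.\<close>
      have "(1 / 2 - a)\<^sup>2 \<le> (sqrt 3 / 6)\<^sup>2"
        using a by (intro power_mono) (auto simp: b2_minus_def field_simps)
      hence c: "0 \<le> 1 / 2 - a" "12 * (1 / 2 - a)\<^sup>2 \<le> 1"
        using a by (auto simp: power_divide)
      show ?thesis
      proof (rule psi_nonzero[where L = "\<lambda>w. - Re w"])
        fix x :: real assume x: "x > 0"
        show "- Re (ker_sub x) > 0"
          unfolding ker_sub_1[OF z x] Re_complex_of_real
          using mult_exp_less_sinh[OF c x] x by (simp add: divide_less_0_iff)
      qed (use s in \<open>auto intro!: bounded_linear_minus bounded_linear_Re\<close>)
    next
      assume a: "b2_plus \<le> a"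
      have le: "sqrt 3 / 6 \<le> a - 1 / 2" using a by (simp add: b2_plus_def field_simps)
      have "(sqrt 3 / 6)\<^sup>2 \<le> (a - 1 / 2)\<^sup>2"
        by (intro power_mono le) auto
      hence c: "0 \<le> a - 1 / 2" "12 * (a - 1 / 2)\<^sup>2 \<ge> 1"
        using order_trans[OF _ le, of 0] by (simp_all add: power_divide)
      show ?thesis
      proof (rule psi_nonzero[where L = Re])
        fix x :: real assume x: "x > 0"
        have "1 - (a - 1 / 2) * x = 1 + (1 / 2 - a) * x" "- (a - 1 / 2) * x = (1 / 2 - a) * x"
          by (simp_all add: algebra_simps)
        hence "2 * sinh (x / 2) * (1 + (1 / 2 - a) * x) < x * exp ((1 / 2 - a) * x)"
          using sinh_less_mult_exp_neg[OF c x] by (simp only:)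
        thus "Re (ker_sub x) > 0"
          unfolding ker_sub_1[OF z x] Re_complex_of_real using x by simp
      qed (use s in \<open>auto intro!: bounded_linear_Re\<close>)
    qed
  qed
next
  assume *: "\<forall>s::real. -2 < s \<and> s < -1 \<longrightarrow> psi (of_real s) \<noteq> 0"
  have "psi (- 1) = of_real (a - 1 / 2)"
    unfolding psi_neg_1 ker_fps_nth_1[OF z] by simp
  hence 1: "Re (psi (- 1)) = a - 1 / 2" by (simp only: Re_complex_of_real)
  have "psi (- 2) = of_real ((a - b2_minus) * (a - b2_plus))"
  proof -
    have "psi (- 2) = of_real (1 - 2 * (3 / 2 - a) + 2 * ((1 - a)\<^sup>2 / 2 + (1 - a) / 2 + 1 / 12))"
      unfolding psi_neg_2 ker_fps_nth_1[OF z] by simp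
    also have "1 - 2 * (3 / 2 - a) + 2 * ((1 - a)\<^sup>2 / 2 + (1 - a) / 2 + 1 / 12) = (a - b2_minus) * (a - b2_plus)"
      by (simp add: b2_minus_def b2_plus_def field_simps power2_eq_square)
    finally show ?thesis .
  qed
  hence 2: "Re (psi (- 2)) = (a - b2_minus) * (a - b2_plus)" by (simp only: Re_complex_of_real)
  have b: "b2_minus < 1 / 2" "1 / 2 < b2_plus" by (simp_all add: b2_minus_def b2_plus_def)
  show "b2_minus \<le> a \<and> a \<le> 1 / 2 \<or> b2_plus \<le> a"
  proof (rule ccontr)
    assume "\<not> ?thesis"
    hence "a < b2_minus \<or> 1 / 2 < a \<and> a < b2_plus" by auto
    hence "(a - 1 / 2) * ((a - b2_minus) * (a - b2_plus)) < 0"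
    proof
      assume "a < b2_minus"
      thus ?thesis using b by (intro mult_neg_pos mult_neg_neg) auto
    next
      assume "1 / 2 < a \<and> a < b2_plus"
      thus ?thesis using b by (intro mult_pos_neg) auto
    qed
    hence "Re (psi (- 1)) * Re (psi (- 2)) < 0" by (simp only: 1 2)
    moreover have "Im (ker_sub x) = 0" if "x > 0" for x
      by (simp only: ker_sub_1[OF z that] Im_complex_of_real)
    ultimately show False using psi_zero_exists * by blast
  qed
qed

end

theorem theorem1p2:
  fixes a :: real and z :: complex
  assumes "0 < a" "a \<le> 1" and "0 < norm z" "norm z \<le> 1"
  shows "(\<forall>\<sigma>::real. -1 < \<sigma> \<and> \<sigma> < 0 \<longrightarrow> hurwitz_lerch (complex_of_real \<sigma>) a z \<noteq> 0) \<longleftrightarrow>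
      (z = 1 \<and> (b2_minus \<le> a \<and> a \<le> 1 / 2 \<or> b2_plus \<le> a \<and> a \<le> 1)) \<or>
      (\<exists>x::real. z = complex_of_real x \<and> -1 \<le> x \<and> x < 1 \<and> (1 - x) * (1 - a) \<le> 1) \<or>
      z \<notin> \<real>"
proof -
  interpret hurwitz_lerch_params a z
    using assms by (intro hurwitz_lerch_params.intro) auto
  consider "z = 1" | x where "z = complex_of_real x" "-1 \<le> x" "x < 1" | "z \<notin> \<real>"
  proof (cases "z \<in> \<real>")
    case True
    then obtain x where x: "z = of_real x" by (auto elim: Reals_cases)
    hence "\<bar>x\<bar> \<le> 1" using assms(4) by simp
    thus ?thesis using that x by (cases "x = 1") auto
  qed (use that in blast)
  thus ?thesis
  proof cases
    case 1
    thus ?thesis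
      unfolding hurwitz_lerch_nonzero_iff psi_nonzero_iff_1[OF 1] using assms(2) by auto
  next
    case (2 x)
    thus ?thesis
      unfolding hurwitz_lerch_nonzero_iff psi_nonzero_iff_real[OF 2(1,3)] by auto
  next
    case 3
    thus ?thesis
      unfolding hurwitz_lerch_nonzero_iff using psi_nonzero_nonreal by auto
  qed
qed

end
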